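(* Let $X$ be a uniformly convex Banach space whose modulus of convexity has power type, i.e. there are $p\in[2,\infty)$ and $K>0$ with $\delta_X(\epsilon)\ge K\epsilon^p$ for all $0<\epsilon\le 2$. Let $\Omega\subset X$ be a domain, let $w\colon\Omega\to(0,\infty)$ be a continuous weight function, and let $\nu$ be the modulus of continuity of $w$. Assume that $$\limsup_{s\to 0+}\frac{\int_0^s \frac{\nu(t)}{t}\,dt}{\nu(s)}<\infty .$$ Then every $d_w$-geodesic $\gamma$ in $\Omega$ is $C^1$ excluding the endpoints.
   Context: $X$ is a real Banach space with $\dim X\ge 2$; a domain is a nonempty open connected set. The modulus of convexity is $$\delta_X(\epsilon)=\inf\{1-\|x+y\|/2:\ x,y\in X,\ \|x\|=\|y\|=1,\ \|x-y\|=\epsilon\},\quad 0<\epsilon\le2,$$ and $X$ is uniformly convex if $\delta_X(\epsilon)>0$ for all $\epsilon>0$. For a continuous weight $w\colon\Omega\to(0,\infty)$, the $w$-length of a rectifiable path $\gamma$ in $\Omega$ is $\ell_w(\gamma)=\int_\gamma w(\gamma)\,\|d\gamma\|$ (integral with respect to norm arc length), and $d_w(x,y)=\inf_\gamma \ell_w(\gamma)$, the infimum being over all rectifiable paths in $\Omega$ joining $x$ and $y$. A $d_w$-geodesic between $x$ and $y$ is a rectifiable path $\gamma$ in $\Omega$ joining $x$ and $y$ with $\ell_w(\gamma)=d_w(x,y)$, parametrized by $w$-length, so $\gamma\colon[0,\ell]\to\Omega$ with $\ell=d_w(x,y)$ and $d_w(\gamma(s),\gamma(t))=|s-t|$. "$C^1$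 excluding the endpoints" means that $\gamma$ is continuously (norm-)differentiable on the open interval $(0,\ell)$. The modulus of continuity of $w$ is $\nu(t)=\sup\{|w(x)-w(y)|:\ x,y\in\Omega,\ \|x-y\|\le t\}$, $t>0$. The limsup condition means that there are constants $C<\infty$ and $s_0>0$ with $\nu(s)<\infty$ and $\int_0^s \frac{\nu(t)}{t}\,dt\le C\,\nu(s)<\infty$ for all $0<s<s_0$. *)

theory Defs
  imports "HOL-Analysis.Analysis"
begin

definition modulus_of_convexity :: "'a::real_normed_vector itself \<Rightarrow> real \<Rightarrow> real" where
  "modulus_of_convexity _ \<epsilon> =
     Inf {1 - norm (x + y) / 2 | x y :: 'a. norm x = 1 \<and> norm y = 1 \<and> norm (x - y) = \<epsilon>}"

definition uniformly_convex :: "'a::real_normed_vector itself \<Rightarrow> bool" where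
  "uniformly_convex X \<longleftrightarrow> (\<forall>\<epsilon>. 0 < \<epsilon> \<and> \<epsilon> \<le> 2 \<longrightarrow> 0 < modulus_of_convexity X \<epsilon>)"

text \<open>Lengths of the polygons inscribed in the restriction of \<open>\<gamma>\<close> to \<open>{a..b}\<close>.\<close>

definition polygon_lengths ::
    "(real \<Rightarrow> 'a::real_normed_vector) \<Rightarrow> real \<Rightarrow> real \<Rightarrow> real set" where
  "polygon_lengths \<gamma> a b =
     {\<Sum>i<n. norm (\<gamma> (t (Suc i)) - \<gamma> (t i)) | (n::nat) (t::nat \<Rightarrow> real).
        t 0 = a \<and> t n = b \<and> (\<forall>i<n. t i \<le> t (Suc i))}"

text \<open>Paths are parametrized by arbitrary compact intervals \<open>{a..b}\<close>; the values of \<open>\<gamma>\<close>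
  outside \<open>{a..b}\<close> play no role.\<close>

definition rectifiable_path_in ::
    "'a::real_normed_vector set \<Rightarrow> (real \<Rightarrow> 'a) \<Rightarrow> real \<Rightarrow> real \<Rightarrow> bool" where
  "rectifiable_path_in \<Omega> \<gamma> a b \<longleftrightarrow>
     a \<le> b \<and> continuous_on {a..b} \<gamma> \<and> \<gamma> ` {a..b} \<subseteq> \<Omega> \<and> bdd_above (polygon_lengths \<gamma> a b)"

definition norm_length :: "(real \<Rightarrow> 'a::real_normed_vector) \<Rightarrow> real \<Rightarrow> real \<Rightarrow> real" where
  "norm_length \<gamma> a b = Sup (polygon_lengths \<gamma> a b)"

text \<open>The integral of \<open>w\<close> along \<open>\<gamma>\<close> with respect to norm arc length is the Stieltjes integral
  against the arc-length function \<open>t \<mapsto> norm_length \<gamma> a t\<close>, which is extended by constants to the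
  left of \<open>a\<close> and to the right of \<open>b\<close> in order to be monotone and continuous on the whole line.\<close>

definition weighted_length ::
    "('a::real_normed_vector \<Rightarrow> real) \<Rightarrow> (real \<Rightarrow> 'a) \<Rightarrow> real \<Rightarrow> real \<Rightarrow> real" where
  "weighted_length w \<gamma> a b =
     (LINT t:{a..b} | interval_measure (\<lambda>t. norm_length \<gamma> a (max a (min b t))). w (\<gamma> t))"

definition weighted_dist ::
    "'a::real_normed_vector set \<Rightarrow> ('a \<Rightarrow> real) \<Rightarrow> 'a \<Rightarrow> 'a \<Rightarrow> real" where
  "weighted_dist \<Omega> w x y =
     Inf {weighted_length w \<gamma> a b | \<gamma> a b.
            rectifiable_path_in \<Omega> \<gamma> a b \<and> \<gamma> a = x \<and> \<gamma> b = y}"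

definition weighted_geodesic ::
    "'a::real_normed_vector set \<Rightarrow> ('a \<Rightarrow> real) \<Rightarrow> 'a \<Rightarrow> 'a \<Rightarrow> (real \<Rightarrow> 'a) \<Rightarrow> bool" where
  "weighted_geodesic \<Omega> w x y \<gamma> \<longleftrightarrow>
     (let l = weighted_dist \<Omega> w x y in
        rectifiable_path_in \<Omega> \<gamma> 0 l \<and> \<gamma> 0 = x \<and> \<gamma> l = y \<and>
        weighted_length w \<gamma> 0 l = l \<and>
        (\<forall>s\<in>{0..l}. \<forall>t\<in>{0..l}. weighted_dist \<Omega> w (\<gamma> s) (\<gamma> t) = \<bar>s - t\<bar>))"

text \<open>The modulus of continuity may be infinite, hence the extended values.\<close>

definition modulus_of_continuity ::
    "'a::real_normed_vector set \<Rightarrow> ('a \<Rightarrow> real) \<Rightarrow> real \<Rightarrow> ennreal" where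
  "modulus_of_continuity \<Omega> w t =
     Sup {ennreal \<bar>w x - w y\<bar> | x y. x \<in> \<Omega> \<and> y \<in> \<Omega> \<and> norm (x - y) \<le> t}"

text \<open>Finiteness of the upper limit, as \<open>s\<close> tends to \<open>0\<close> from the right, of the quotient of
  \<open>\<integral>\<^sub>0\<^sup>s \<nu>(t)/t dt\<close> by \<open>\<nu>(s)\<close>, written without division so that \<open>\<nu>(s) = 0\<close> is allowed.\<close>

definition finite_limsup_condition :: "(real \<Rightarrow> ennreal) \<Rightarrow> bool" where
  "finite_limsup_condition \<nu> \<longleftrightarrow>
     (\<exists>C s0. C < \<infinity> \<and> 0 < s0 \<and>
        (\<forall>s. 0 < s \<and> s < s0 \<longrightarrow>
           \<nu> s < \<infinity> \<and>
           (\<integral>\<^sup>+t\<in>{0<..<s}. \<nu> t / ennreal t \<partial>lborel) \<le> C * \<nu> s))"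

end

theory Submission
  imports Defs
begin

text \<open>Let \<open>z = \<gamma> u\<close> lie between \<open>x = \<gamma> s\<close> and \<open>y = \<gamma> t\<close> on the geodesic. Comparison of
  \<open>d\<^sub>w\<close> with \<open>w(z)\<close> times the norm distance, the error being controlled by \<open>\<nu>\<close>, shows that
  \<open>norm (x - y)\<close> is almost \<open>norm (x - z) + norm (z - y)\<close>. The power type modulus of convexity
  then forces the difference quotients of \<open>\<gamma>\<close> over \<open>[s, u]\<close> and \<open>[u, t]\<close> to differ by at most a
  constant times \<open>\<nu>(c(t - s))\<close> to the power \<open>1/p\<close>. By the limsup condition \<open>\<nu>\<close> has a majorant that
  decays geometrically along \<open>s/4^k\<close>, so these errors are summable over scales and the
  difference quotients are uniformly Cauchy, which is continuous differentiability.\<close>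

section \<open>Arc length\<close>

text \<open>Convexity of power type turns an error \<nu> into an error \<nu>^(1/p), and this root is
  the obstacle. Convergence of the integral of \<nu>(t)/t only makes \<nu> summable along s/4^k; the
  p-th roots may still have a divergent sum. Geometric decay survives the root, with ratio
  \<theta>^(1/p) in place of \<theta>, and this is what the limsup condition supplies beyond
  convergence.

  The convexity estimate also degenerates when u is close to s or to t: if c*a + (1-c)*b is almost a
  unit vector, a and b are close with a constant that grows like 1/min(c, 1-c). Hence u is kept
  between the quarter points of [s, t], and quotients over intervals of very different lengths are
  compared through chains of such steps.

  The factor inside \<nu> is 1/m, where m is a local lower bound of w: distance h in
  \<open>d_w\<close> forces norm distance at most h/m, so only the oscillation of w on a ball of
  radius (t-s)/m about z matters.\<close>

text \<open>Argument order: the end point \<open>b\<close>, being the fixed parameter, precedes the starting point.\<close>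

inductive polygon_length :: "(real \<Rightarrow> 'a::real_normed_vector) \<Rightarrow> real \<Rightarrow> real \<Rightarrow> real \<Rightarrow> bool"
  for \<gamma> b where
  trivial: "polygon_length \<gamma> b b 0"
| step: "a \<le> c \<Longrightarrow> polygon_length \<gamma> b c s \<Longrightarrow> polygon_length \<gamma> b a (norm (\<gamma> c - \<gamma> a) + s)"

lemma polygon_length_le: "polygon_length \<gamma> b a s \<Longrightarrow> a \<le> b"
  by (induction rule: polygon_length.induct) auto

lemma polygon_length_sum:
  assumes "t n = b" "\<forall>i<n. t i \<le> t (Suc i)"
  shows "polygon_length \<gamma> b (t 0) (\<Sum>i<n. norm (\<gamma> (t (Suc i)) - \<gamma> (t i)))"
  using assms
proof (induction n arbitrary: t)
  case 0
  then show ?case by (auto intro: polygon_length.trivial)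
next
  case (Suc n)
  have "polygon_length \<gamma> b (t (Suc 0)) (\<Sum>i<n. norm (\<gamma> (t (Suc (Suc i))) - \<gamma> (t (Suc i))))"
    using Suc.IH[of "\<lambda>i. t (Suc i)"] Suc.prems by auto
  then show ?case
    using Suc.prems(2) unfolding sum.lessThan_Suc_shift by (auto intro: polygon_length.step)
qed

text \<open>Replaces index arithmetic on subdivisions by induction on the first edge, which all
  later facts about polygons use.\<close>

lemma polygon_lengths_eq: "polygon_lengths \<gamma> a b = {s. polygon_length \<gamma> b a s}"
proof (intro equalityI subsetI CollectI)
  fix s assume "s \<in> polygon_lengths \<gamma> a b"
  then show "polygon_length \<gamma> b a s"
    unfolding polygon_lengths_def using polygon_length_sum by blast
next
  fix s assume "s \<in> {s. polygon_length \<gamma> b a s}"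
  then have "polygon_length \<gamma> b a s" by simp
  then show "s \<in> polygon_lengths \<gamma> a b"
  proof (induction rule: polygon_length.induct)
    case trivial
    show ?case unfolding polygon_lengths_def
      by (rule CollectI, rule exI[of _ 0], rule exI[of _ "\<lambda>_. b"]) auto
  next
    case (step a c s)
    then obtain n t where t: "s = (\<Sum>i<n. norm (\<gamma> (t (Suc i)) - \<gamma> (t i)))" "t 0 = c" "t n = b"
      "\<forall>i<n. t i \<le> t (Suc i)"
      unfolding polygon_lengths_def by blast
    show ?case unfolding polygon_lengths_def
      apply (rule CollectI, rule exI[of _ "Suc n"],
          rule exI[of _ "\<lambda>i. case i of 0 \<Rightarrow> a | Suc j \<Rightarrow> t j"])
      using t step.hyps unfolding sum.lessThan_Suc_shift by (auto split: nat.split)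
  qed
qed

lemma polygon_length_concat:
  "polygon_length \<gamma> b a s \<Longrightarrow> polygon_length \<gamma> c b s' \<Longrightarrow> polygon_length \<gamma> c a (s + s')"
  by (induction rule: polygon_length.induct)
    (auto intro: polygon_length.step simp: add.assoc)

lemma polygon_length_segment:
  assumes "a \<le> b"
  shows "polygon_length \<gamma> b a (norm (\<gamma> b - \<gamma> a))"
  using polygon_length.step[OF assms polygon_length.trivial[of \<gamma> b]] by simp

text \<open>Inserting b as a vertex of the edge that passes over it does not shorten the polygon, by
  the triangle inequality. This is the subadditive half of \<open>norm_length_add\<close>.\<close>

lemma polygon_length_split:
  assumes "polygon_length \<gamma> c a s" "a \<le> b" "b \<le> c"
  shows "\<exists>s1 s2. polygon_length \<gamma> b a s1 \<and> polygon_length \<gamma> c b s2 \<and> s \<le> s1 + s2"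
  using assms
proof (induction rule: polygon_length.induct)
  case trivial
  then have "b = c" by simp
  then show ?case using polygon_length.trivial[of \<gamma> c] by force
next
  case (step a d s)
  show ?case
  proof (cases "b \<le> d")
    case True
    have "norm (\<gamma> d - \<gamma> a) \<le> norm (\<gamma> b - \<gamma> a) + norm (\<gamma> d - \<gamma> b)"
      using norm_triangle_ineq[of "\<gamma> b - \<gamma> a" "\<gamma> d - \<gamma> b"] by simp
    then show ?thesis
      using polygon_length_segment[OF step.prems(1), of \<gamma>] polygon_length.step[OF True step.hyps(2)]
      by force
  next
    case False
    then obtain s1 s2 where "polygon_length \<gamma> b d s1" "polygon_length \<gamma> c b s2" "s \<le> s1 + s2"
      using step.IH step.prems by auto
    then show ?thesis using polygon_length.step[OF step.hyps(1)] by force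
  qed
qed

text \<open>Moving the starting point slightly to the right changes only the first nondegenerate
  edge, and by less than e. Edges with a = c have length 0 and are skipped by the induction
  hypothesis.\<close>

lemma polygon_length_tail:
  assumes "polygon_length \<gamma> b a s" "a < b" "continuous (at_right a) \<gamma>" "0 < e"
  shows "\<exists>d>a. \<forall>t. a < t \<and> t < d \<longrightarrow> (\<exists>s'. polygon_length \<gamma> b t s' \<and> s \<le> s' + e)"
  using assms
proof (induction rule: polygon_length.induct)
  case trivial
  then show ?case by simp
next
  case (step a c s)
  show ?case
  proof (cases "a = c")
    case True
    then show ?thesis using step by simp
  next
    case False
    have "\<forall>\<^sub>F t in at_right a. dist (\<gamma> t) (\<gamma> a) < e"
      using step.prems by (auto simp: continuous_within dest: tendstoD)
    then obtain d where d: "d > a" "\<forall>t>a. t < d \<longrightarrow> norm (\<gamma> t - \<gamma> a) < e"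
      unfolding eventually_at_right_field dist_norm by blast
    have "\<exists>s'. polygon_length \<gamma> b t s' \<and> norm (\<gamma> c - \<gamma> a) + s \<le> s' + e"
      if t: "a < t" "t < min c d" for t
    proof -
      have "norm (\<gamma> c - \<gamma> a) \<le> norm (\<gamma> c - \<gamma> t) + norm (\<gamma> t - \<gamma> a)"
        using norm_triangle_ineq[of "\<gamma> c - \<gamma> t" "\<gamma> t - \<gamma> a"] by simp
      moreover have "norm (\<gamma> t - \<gamma> a) < e" using d t by simp
      ultimately show ?thesis
        using polygon_length.step[of t c \<gamma> b s] step.hyps t by (intro exI[of _ "norm (\<gamma> c - \<gamma> t) + s"]) auto
    qed
    then show ?thesis using d False step.hyps by (intro exI[of _ "min c d"]) auto
  qed
qed

section \<open>Norm length as a supremum, and its additivity\<close>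

lemma norm_length_upper:
  assumes "bdd_above (polygon_lengths \<gamma> a b)" "polygon_length \<gamma> b a s"
  shows "s \<le> norm_length \<gamma> a b"
  unfolding norm_length_def using assms by (auto intro!: cSup_upper simp: polygon_lengths_eq)

lemma norm_length_least:
  assumes "a \<le> b" "\<And>s. polygon_length \<gamma> b a s \<Longrightarrow> s \<le> B"
  shows "norm_length \<gamma> a b \<le> B"
  unfolding norm_length_def polygon_lengths_eq
  using assms polygon_length_segment[OF assms(1), of \<gamma>] by (intro cSup_least) auto

lemma bdd_polygon_lengths_subinterval:
  assumes bdd: "bdd_above (polygon_lengths \<gamma> a b)" and "a \<le> c" "c \<le> d" "d \<le> b"
  shows "bdd_above (polygon_lengths \<gamma> c d)"
proof -
  obtain B where B: "\<And>s. polygon_length \<gamma> b a s \<Longrightarrow> s \<le> B"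
    using bdd unfolding polygon_lengths_eq bdd_above_def by auto
  have "s \<le> B" if "polygon_length \<gamma> d c s" for s
    using B[OF polygon_length_concat[OF polygon_length_segment[OF \<open>a \<le> c\<close>]
      polygon_length_concat[OF that polygon_length_segment[OF \<open>d \<le> b\<close>]]]]
    by (meson le_add_same_cancel1 le_add_same_cancel2 norm_ge_zero order_trans)
  then show ?thesis unfolding polygon_lengths_eq bdd_above_def by auto
qed

lemma norm_length_nonneg:
  assumes "bdd_above (polygon_lengths \<gamma> a b)" "a \<le> b"
  shows "0 \<le> norm_length \<gamma> a b"
  using norm_length_upper[OF assms(1) polygon_length_segment[OF assms(2)]] norm_ge_zero order_trans
  by blast

lemma norm_length_refl: "norm_length \<gamma> a a = 0"
proof -
  have "s \<le> 0" if "polygon_length \<gamma> b a s" "b = a" for s b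
    using that
  proof (induction rule: polygon_length.induct)
    case (step a c s)
    then show ?case using polygon_length_le[OF step.hyps(2)] by force
  qed simp
  then have "{s. polygon_length \<gamma> a a s} \<subseteq> {..0}" by auto
  then have "bdd_above (polygon_lengths \<gamma> a a)"
    unfolding polygon_lengths_eq by (meson bdd_above_Iic bdd_above_mono)
  with \<open>{s. polygon_length \<gamma> a a s} \<subseteq> {..0}\<close> show ?thesis
    using norm_length_nonneg[of \<gamma> a a] norm_length_least[of a a \<gamma> 0] by force
qed

lemma norm_length_add:
  assumes bdd: "bdd_above (polygon_lengths \<gamma> a c)" and "a \<le> b" "b \<le> c"
  shows "norm_length \<gamma> a c = norm_length \<gamma> a b + norm_length \<gamma> b c"
proof (rule antisym)
  note b1 = bdd_polygon_lengths_subinterval[OF bdd order_refl \<open>a \<le> b\<close> \<open>b \<le> c\<close>]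
  note b2 = bdd_polygon_lengths_subinterval[OF bdd \<open>a \<le> b\<close> \<open>b \<le> c\<close> order_refl]
  show "norm_length \<gamma> a c \<le> norm_length \<gamma> a b + norm_length \<gamma> b c"
  proof (rule norm_length_least)
    fix s assume "polygon_length \<gamma> c a s"
    then obtain s1 s2 where "polygon_length \<gamma> b a s1" "polygon_length \<gamma> c b s2" "s \<le> s1 + s2"
      using polygon_length_split assms by blast
    then show "s \<le> norm_length \<gamma> a b + norm_length \<gamma> b c"
      using norm_length_upper[OF b1] norm_length_upper[OF b2] by (meson add_mono order_trans)
  qed (use assms in auto)
  \<comment> \<open>Concatenation bounds s1 + s for every pair of polygons. The supremum is taken
    over s with s1 fixed, and afterwards over s1.\<close>
  have "s1 \<le> norm_length \<gamma> a c - norm_length \<gamma> b c" if s1: "polygon_length \<gamma> b a s1" for s1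
  proof -
    have "norm_length \<gamma> b c \<le> norm_length \<gamma> a c - s1"
    proof (rule norm_length_least)
      fix s assume "polygon_length \<gamma> c b s"
      then show "s \<le> norm_length \<gamma> a c - s1"
        using norm_length_upper[OF bdd polygon_length_concat[OF s1]] by force
    qed fact
    then show ?thesis by simp
  qed
  then have "norm_length \<gamma> a b \<le> norm_length \<gamma> a c - norm_length \<gamma> b c"
    by (rule norm_length_least[OF \<open>a \<le> b\<close>])
  then show "norm_length \<gamma> a b + norm_length \<gamma> b c \<le> norm_length \<gamma> a c" by simp
qed

text \<open>This is exactly the distribution function inside \<open>weighted_length\<close>; the
  clamping makes it a function on the whole line, as \<open>interval_measure\<close>
  expects.\<close>

definition arc_length :: "(real \<Rightarrow> 'a::real_normed_vector) \<Rightarrow> real \<Rightarrow> real \<Rightarrow> real \<Rightarrow> real" where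
  "arc_length \<gamma> a b t = norm_length \<gamma> a (max a (min b t))"

lemma arc_length_diff:
  assumes "bdd_above (polygon_lengths \<gamma> a b)" "a \<le> s" "s \<le> t" "t \<le> b"
  shows "arc_length \<gamma> a b t - arc_length \<gamma> a b s = norm_length \<gamma> s t"
  using norm_length_add[OF bdd_polygon_lengths_subinterval[OF assms(1), of a t], of s] assms
  by (simp add: arc_length_def)

lemma arc_length_mono:
  assumes bdd: "bdd_above (polygon_lengths \<gamma> a b)" "a \<le> b" and "s \<le> t"
  shows "arc_length \<gamma> a b s \<le> arc_length \<gamma> a b t"
proof -
  let ?c = "\<lambda>t. max a (min b t)"
  have "arc_length \<gamma> a b (?c t) - arc_length \<gamma> a b (?c s) = norm_length \<gamma> (?c s) (?c t)"
    using assms by (intro arc_length_diff) auto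
  moreover have "0 \<le> norm_length \<gamma> (?c s) (?c t)"
    using assms by (intro norm_length_nonneg bdd_polygon_lengths_subinterval[OF bdd(1)]) auto
  ultimately show ?thesis using bdd by (simp add: arc_length_def)
qed

text \<open>A polygon on [u, b] within e/2 of the supremum stays within another e/2 when it starts
  at t slightly after u. Additivity then leaves less than e for the piece [u, t].\<close>

lemma arc_length_right_continuous:
  assumes path: "rectifiable_path_in \<Omega> \<gamma> a b"
  shows "continuous (at_right u) (arc_length \<gamma> a b)"
proof -
  have ab: "a \<le> b" and cont: "continuous_on {a..b} \<gamma>" and bdd: "bdd_above (polygon_lengths \<gamma> a b)"
    using path by (auto simp: rectifiable_path_in_def)
  consider "u < a" | "b \<le> u" | "a \<le> u" "u < b" by linarith
  then show ?thesis
  proof cases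
    case 1
    have "\<forall>\<^sub>F t in at_right u. arc_length \<gamma> a b t = arc_length \<gamma> a b u"
      unfolding eventually_at_right_field using 1 ab
      by (intro exI[of _ a]) (auto simp: arc_length_def)
    then show ?thesis unfolding continuous_within by (rule tendsto_eventually)
  next
    case 2
    have "\<forall>\<^sub>F t in at_right u. arc_length \<gamma> a b t = arc_length \<gamma> a b u"
      unfolding eventually_at_right_field using 2 ab
      by (intro exI[of _ "u + 1"]) (auto simp: arc_length_def)
    then show ?thesis unfolding continuous_within by (rule tendsto_eventually)
  next
    case 3
    note bu = bdd_polygon_lengths_subinterval[OF bdd 3(1) less_imp_le[OF 3(2)] order_refl]
    have "(\<gamma> \<longlongrightarrow> \<gamma> u) (at u within {a..b})"
      using cont 3 by (auto simp: continuous_on_def)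
    then have "(\<gamma> \<longlongrightarrow> \<gamma> u) (at u within {u..b})"
      by (rule tendsto_within_subset) (use 3 in auto)
    then have cu: "continuous (at_right u) \<gamma>"
      using 3 by (simp add: continuous_within at_within_Icc_at_right)
    show ?thesis
      unfolding continuous_within
    proof (rule tendstoI)
      fix e :: real assume "0 < e"
      have "polygon_lengths \<gamma> u b \<noteq> {}" 
        using polygon_length_segment[of u b \<gamma>] 3 by (auto simp: polygon_lengths_eq)
      then obtain s where s: "polygon_length \<gamma> b u s" "norm_length \<gamma> u b - e/2 < s"
        using less_cSup_iff[OF _ bu, of "norm_length \<gamma> u b - e/2"] \<open>0 < e\<close>
        unfolding norm_length_def by (auto simp: polygon_lengths_eq)
      obtain d where d: "d > u" "\<And>t. u < t \<Longrightarrow> t < d \<Longrightarrow> \<exists>s'. polygon_length \<gamma> b t s' \<and> s \<le> s' + e/2"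
        using polygon_length_tail[OF s(1) 3(2) cu, of "e/2"] \<open>0 < e\<close> by auto
      have "dist (arc_length \<gamma> a b t) (arc_length \<gamma> a b u) < e" if t: "u < t" "t < min d b" for t
      proof -
        obtain s' where s': "polygon_length \<gamma> b t s'" "s \<le> s' + e/2" using d t by auto
        have "bdd_above (polygon_lengths \<gamma> t b)"
          using t 3 by (intro bdd_polygon_lengths_subinterval[OF bdd]) auto
        then have "s' \<le> norm_length \<gamma> t b" using s' norm_length_upper by blast
        moreover have "norm_length \<gamma> u b = norm_length \<gamma> u t + norm_length \<gamma> t b"
          using t by (intro norm_length_add[OF bu]) auto
        moreover have "arc_length \<gamma> a b t - arc_length \<gamma> a b u = norm_length \<gamma> u t"
          using t 3 by (intro arc_length_diff[OF bdd]) auto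
        moreover have "arc_length \<gamma> a b u \<le> arc_length \<gamma> a b t"
          using t by (intro arc_length_mono[OF bdd ab]) auto
        ultimately show ?thesis using s s' by (simp add: dist_real_def)
      qed
      then show "\<forall>\<^sub>F t in at_right u. dist (arc_length \<gamma> a b t) (arc_length \<gamma> a b u) < e"
        unfolding eventually_at_right_field using d 3 by (intro exI[of _ "min d b"]) auto
    qed
  qed
qed

section \<open>Weighted distance\<close>

lemma weighted_length_arc_length:
  "weighted_length w \<gamma> a b = (LINT t:{a..b} | interval_measure (arc_length \<gamma> a b). w (\<gamma> t))"
  by (simp add: weighted_length_def arc_length_def[abs_def])

lemma emeasure_arc_length_Ioc:
  assumes "rectifiable_path_in \<Omega> \<gamma> a b" "s \<le> t"
  shows "emeasure (interval_measure (arc_length \<gamma> a b)) {s<..t}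
    = ennreal (arc_length \<gamma> a b t - arc_length \<gamma> a b s)"
  using assms
  by (intro emeasure_interval_measure_Ioc arc_length_mono arc_length_right_continuous)
    (auto simp: rectifiable_path_in_def)

lemma emeasure_arc_length_finite:
  assumes "rectifiable_path_in \<Omega> \<gamma> a b"
  shows "emeasure (interval_measure (arc_length \<gamma> a b)) {a..b} < \<infinity>"
proof -
  have "a \<le> b" using assms by (simp add: rectifiable_path_in_def)
  \<comment> \<open>Interval measures are known on half-open intervals. Starting at a - 1 includes
    the point a at no cost, because \<open>arc_length\<close> is constant to the left of a.\<close>
  then have "emeasure (interval_measure (arc_length \<gamma> a b)) {a..b}
      \<le> emeasure (interval_measure (arc_length \<gamma> a b)) {a - 1<..b}"
    by (intro emeasure_mono) auto
  also have "\<dots> < \<infinity>"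
    using \<open>a \<le> b\<close> by (subst emeasure_arc_length_Ioc[OF assms]) auto
  finally show ?thesis .
qed

lemma set_integrable_weight:
  assumes path: "rectifiable_path_in \<Omega> \<gamma> a b" and w: "continuous_on \<Omega> w"
  shows "set_integrable (interval_measure (arc_length \<gamma> a b)) {a..b} (\<lambda>t. w (\<gamma> t) :: real)"
proof -
  have c: "continuous_on {a..b} (\<lambda>t. w (\<gamma> t))"
    using path by (auto intro!: continuous_on_compose2[OF w] simp: rectifiable_path_in_def)
  then have "bounded ((\<lambda>t. w (\<gamma> t)) ` {a..b})"
    by (intro compact_imp_bounded compact_continuous_image) auto
  then obtain B where B: "\<And>t. t \<in> {a..b} \<Longrightarrow> norm (w (\<gamma> t)) \<le> B"
    unfolding bounded_iff by blast
  \<comment> \<open>The composition with \<gamma> is measurable only after cutting off outside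
    {a..b}. The bounded integrability criterion is applied to this cut-off function and adds a
    second indicator, which is absorbed afterwards.\<close>
  have "integrable (interval_measure (arc_length \<gamma> a b))
     (\<lambda>t. indicator {a..b} t *\<^sub>R (indicator {a..b} t *\<^sub>R w (\<gamma> t)))"
  proof (rule integrableI_bounded_set_indicator[where B = B])
    show "(\<lambda>t. indicator {a..b} t *\<^sub>R w (\<gamma> t)) \<in> borel_measurable (interval_measure (arc_length \<gamma> a b))"
      using borel_measurable_continuous_on_indicator[OF _ c] by simp
  qed (use emeasure_arc_length_finite[OF path] B in auto)
  moreover have "(\<lambda>t. indicator {a..b} t *\<^sub>R (indicator {a..b} t *\<^sub>R w (\<gamma> t)))
      = (\<lambda>t. indicator {a..b} t *\<^sub>R w (\<gamma> t))"
    by (auto split: split_indicator)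
  ultimately show ?thesis unfolding set_integrable_def by (simp only:)
qed

lemma weighted_length_nonneg:
  assumes "rectifiable_path_in \<Omega> \<gamma> a b" "\<And>z. z \<in> \<Omega> \<Longrightarrow> 0 < w z"
  shows "0 \<le> weighted_length w \<gamma> a b"
  unfolding weighted_length_def set_lebesgue_integral_def
  using assms by (intro integral_nonneg_AE AE_I2)
    (auto simp: rectifiable_path_in_def indicator_def image_subset_iff less_imp_le)

text \<open>The part of the path after c contributes a nonnegative amount since w > 0, so a lower
  bound for w is asked for only up to c. In the application c is the first exit time from a
  ball.\<close>

lemma weighted_length_ge:
  assumes path: "rectifiable_path_in \<Omega> \<gamma> a b" and w: "continuous_on \<Omega> w" "\<And>z. z \<in> \<Omega> \<Longrightarrow> 0 < w z"
    and c: "a \<le> c" "c \<le> b" and m: "0 \<le> m" "\<And>t. a \<le> t \<Longrightarrow> t \<le> c \<Longrightarrow> m \<le> w (\<gamma> t)"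
  shows "m * norm (\<gamma> c - \<gamma> a) \<le> weighted_length w \<gamma> a b"
proof -
  let ?\<mu> = "interval_measure (arc_length \<gamma> a b)"
  have bdd: "bdd_above (polygon_lengths \<gamma> a b)" and in\<Omega>: "\<And>t. a \<le> t \<Longrightarrow> t \<le> b \<Longrightarrow> \<gamma> t \<in> \<Omega>"
    using path by (auto simp: rectifiable_path_in_def)
  have fin: "emeasure ?\<mu> {a<..c} < \<infinity>"
    using c by (subst emeasure_arc_length_Ioc[OF path]) auto
  have diff: "arc_length \<gamma> a b c - arc_length \<gamma> a b a = norm_length \<gamma> a c"
    using c by (intro arc_length_diff bdd) auto
  have bdd': "bdd_above (polygon_lengths \<gamma> a c)"
    using c by (intro bdd_polygon_lengths_subinterval[OF bdd]) auto
  have "norm (\<gamma> c - \<gamma> a) \<le> norm_length \<gamma> a c"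
    using norm_length_upper[OF bdd' polygon_length_segment] c by auto
  also have "\<dots> = measure ?\<mu> {a<..c}"
    using c norm_length_nonneg[OF bdd' c(1)] unfolding measure_def
    by (subst emeasure_arc_length_Ioc[OF path]) (auto simp: diff)
  finally have "m * norm (\<gamma> c - \<gamma> a) \<le> m * measure ?\<mu> {a<..c}"
    by (intro mult_left_mono m)
  also have "\<dots> = (LINT t|?\<mu>. m * indicator {a<..c} t)"
    by simp
  also have "\<dots> \<le> (LINT t|?\<mu>. indicator {a..b} t *\<^sub>R w (\<gamma> t))"
  proof (rule integral_mono)
    show "integrable ?\<mu> (\<lambda>t. m * indicator {a<..c} t)"
      using fin by (intro integrable_mult_right integrable_real_indicator) auto
    show "integrable ?\<mu> (\<lambda>t. indicator {a..b} t *\<^sub>R w (\<gamma> t))"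
      using set_integrable_weight[OF path w(1)] by (simp add: set_integrable_def)
    show "m * indicator {a<..c} t \<le> indicator {a..b} t *\<^sub>R w (\<gamma> t)" for t
      using m c in\<Omega> w(2) by (auto simp: indicator_def intro: less_imp_le)
  qed
  finally show ?thesis
    by (simp add: weighted_length_arc_length set_lebesgue_integral_def)
qed

section \<open>Comparison of the weighted distance with the norm\<close>

text \<open>All edges of a polygon inscribed in a segment are nonnegative multiples of y - x, so
  every inscribed polygon over [0, 1] has the same length.\<close>

lemma segment_path:
  fixes x y :: "'a::real_normed_vector"
  defines "\<sigma> \<equiv> \<lambda>t. x + t *\<^sub>R (y - x)"
  assumes sub: "closed_segment x y \<subseteq> \<Omega>"
  shows "rectifiable_path_in \<Omega> \<sigma> 0 1" "norm_length \<sigma> 0 1 = norm (y - x)"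
proof -
  have "s = (b - a) * norm (y - x)" if "polygon_length \<sigma> b a s" for a b s
    using that
  proof (induction rule: polygon_length.induct)
    case (step a c s)
    have "\<sigma> c - \<sigma> a = (c - a) *\<^sub>R (y - x)"
      by (simp add: \<sigma>_def algebra_simps)
    then have "norm (\<sigma> c - \<sigma> a) = (c - a) * norm (y - x)"
      using step.hyps by simp
    then show ?case using step.IH by (simp add: algebra_simps)
  qed simp
  then have len: "s = norm (y - x)" if "polygon_length \<sigma> 1 0 s" for s
    using that by fastforce
  then have bdd: "bdd_above (polygon_lengths \<sigma> 0 1)"
    unfolding polygon_lengths_eq by (auto simp: bdd_above_def)
  have "\<sigma> t \<in> closed_segment x y" if "0 \<le> t" "t \<le> 1" for t
    unfolding in_segment using that by (intro exI[of _ t]) (auto simp: \<sigma>_def algebra_simps)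
  with bdd sub show "rectifiable_path_in \<Omega> \<sigma> 0 1"
    unfolding rectifiable_path_in_def by (auto simp: \<sigma>_def intro!: continuous_intros)
  show "norm_length \<sigma> 0 1 = norm (y - x)"
    using norm_length_upper[OF bdd polygon_length_segment] norm_length_least[of 0 1 \<sigma> "norm (y - x)"] len
    by (fastforce intro: antisym simp: \<sigma>_def)
qed

lemma weighted_dist_le:
  assumes sub: "closed_segment x y \<subseteq> \<Omega>" and w: "continuous_on \<Omega> w" "\<And>z. z \<in> \<Omega> \<Longrightarrow> 0 < w z"
    and M: "\<And>z. z \<in> closed_segment x y \<Longrightarrow> w z \<le> M"
  shows "weighted_dist \<Omega> w x y \<le> M * norm (x - y)"
proof -
  define \<sigma> where "\<sigma> = (\<lambda>t. x + t *\<^sub>R (y - x))"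
  note path = segment_path(1)[OF sub, folded \<sigma>_def]
  let ?\<mu> = "interval_measure (arc_length \<sigma> 0 1)"
  have seg: "\<sigma> t \<in> closed_segment x y" if "0 \<le> t" "t \<le> 1" for t
    unfolding in_segment using that by (intro exI[of _ t]) (auto simp: \<sigma>_def algebra_simps)
  have M0: "0 \<le> M"
    using M[of x] w(2)[of x] sub by (meson ends_in_segment(1) less_imp_le order_trans subsetD)
  \<comment> \<open>As before, the left end -1 makes a half-open interval that covers {0..1};
    clamping gives \<open>arc_length\<close> the value 0 there.\<close>
  have fin: "emeasure ?\<mu> {-1<..1} < \<infinity>"
    by (subst emeasure_arc_length_Ioc[OF path]) auto
  have diff: "arc_length \<sigma> 0 1 1 - arc_length \<sigma> 0 1 (-1) = norm (x - y)"
    using segment_path(2)[OF sub] norm_minus_commute[of x y]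
    by (simp add: arc_length_def norm_length_refl \<sigma>_def)
  have "weighted_length w \<sigma> 0 1 \<le> (LINT t|?\<mu>. M * indicator {-1<..1} t)"
    unfolding weighted_length_arc_length set_lebesgue_integral_def
  proof (rule integral_mono)
    show "integrable ?\<mu> (\<lambda>t. M * indicator {-1<..1} t)"
      using fin by (intro integrable_mult_right integrable_real_indicator) auto
    show "integrable ?\<mu> (\<lambda>t. indicator {0..1} t *\<^sub>R w (\<sigma> t))"
      using set_integrable_weight[OF path w(1)] by (simp add: set_integrable_def)
    show "indicator {0..1} t *\<^sub>R w (\<sigma> t) \<le> M * indicator {-1<..1} t" for t
      using M0 M[OF seg] by (auto simp: indicator_def)
  qed
  also have "\<dots> = M * measure ?\<mu> {-1<..1}" by simp
  also have "measure ?\<mu> {-1<..1} = norm (x - y)"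
    unfolding measure_def by (subst emeasure_arc_length_Ioc[OF path]) (auto simp: diff)
  finally have len: "weighted_length w \<sigma> 0 1 \<le> M * norm (x - y)" .
  have "weighted_dist \<Omega> w x y \<le> weighted_length w \<sigma> 0 1"
    unfolding weighted_dist_def
  proof (rule cInf_lower)
    show "weighted_length w \<sigma> 0 1 \<in> {weighted_length w \<gamma> a b |\<gamma> a b.
        rectifiable_path_in \<Omega> \<gamma> a b \<and> \<gamma> a = x \<and> \<gamma> b = y}"
      using path by (force simp: \<sigma>_def)
    show "bdd_below {weighted_length w \<gamma> a b |\<gamma> a b.
        rectifiable_path_in \<Omega> \<gamma> a b \<and> \<gamma> a = x \<and> \<gamma> b = y}"
      using weighted_length_nonneg w(2) by (intro bdd_belowI[of _ 0]) blast
  qed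
  with len show ?thesis by simp
qed

text \<open>A path from \<open>x\<close> to \<open>y\<close> already has norm length at least \<open>norm (x - y)\<close> when it first leaves
  the open ball of that radius around \<open>x\<close>.\<close>

lemma weighted_dist_ge:
  assumes sub: "closed_segment x y \<subseteq> \<Omega>" and w: "continuous_on \<Omega> w" "\<And>z. z \<in> \<Omega> \<Longrightarrow> 0 < w z"
    and m: "0 \<le> m" "\<And>z. z \<in> \<Omega> \<Longrightarrow> norm (z - x) \<le> norm (x - y) \<Longrightarrow> m \<le> w z"
  shows "m * norm (x - y) \<le> weighted_dist \<Omega> w x y"
  unfolding weighted_dist_def
proof (rule cInf_greatest)
  \<comment> \<open>The segment from x to y is a competitor, so the infimum is not over the empty
    set.\<close>
  show "{weighted_length w \<gamma> a b |\<gamma> a b. rectifiable_path_in \<Omega> \<gamma> a b \<and> \<gamma> a = x \<and> \<gamma> b = y} \<noteq> {}"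
  proof -
    let ?\<sigma> = "\<lambda>t. x + t *\<^sub>R (y - x)"
    have "rectifiable_path_in \<Omega> ?\<sigma> 0 1" "?\<sigma> 0 = x" "?\<sigma> 1 = y"
      using segment_path(1)[OF sub] by simp_all
    then show ?thesis by blast
  qed
next
  fix L assume "L \<in> {weighted_length w \<gamma> a b |\<gamma> a b. rectifiable_path_in \<Omega> \<gamma> a b \<and> \<gamma> a = x \<and> \<gamma> b = y}"
  then obtain \<gamma> a b where L: "L = weighted_length w \<gamma> a b"
    and path: "rectifiable_path_in \<Omega> \<gamma> a b" and ends: "\<gamma> a = x" "\<gamma> b = y" by blast
  have ab: "a \<le> b" and cont: "continuous_on {a..b} \<gamma>" and in\<Omega>: "\<And>t. a \<le> t \<Longrightarrow> t \<le> b \<Longrightarrow> \<gamma> t \<in> \<Omega>"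
    using path by (auto simp: rectifiable_path_in_def)
  let ?f = "\<lambda>t. norm (\<gamma> t - x)"
  have cf: "continuous_on {a..b} ?f" by (intro continuous_intros cont)
  define S where "S = {t \<in> {a..b}. ?f t = norm (x - y)}"
  have "compact S"
    unfolding S_def compact_eq_bounded_closed
    using continuous_closed_preimage_constant[OF cf closed_atLeastAtMost]
    by (auto intro: bounded_subset[OF bounded_closed_interval[of a b]])
  moreover have "b \<in> S" using ends ab by (auto simp: S_def norm_minus_commute)
  ultimately obtain c where c: "c \<in> S" "\<And>t. t \<in> S \<Longrightarrow> c \<le> t"
    using compact_attains_inf[of S] by blast
  \<comment> \<open>If the path were outside the closed ball before time c, the intermediate value
    theorem would give an earlier point of S, starting from distance 0 at a.\<close>
  have "?f t \<le> norm (x - y)" if t: "a \<le> t" "t \<le> c" for t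
  proof (rule ccontr)
    assume *: "\<not> ?thesis"
    have "continuous_on {a..t} ?f" using cf by (rule continuous_on_subset) (use t c in \<open>auto simp: S_def\<close>)
    then obtain u where "a \<le> u" "u \<le> t" "?f u = norm (x - y)"
      using IVT'[of ?f a "norm (x - y)" t] * ends t by auto
    then have "u \<in> S" "u \<noteq> t" using * t c(1) by (auto simp: S_def)
    then show False using c(2)[of u] \<open>u \<le> t\<close> t by auto
  qed
  then have "m * norm (\<gamma> c - \<gamma> a) \<le> weighted_length w \<gamma> a b"
    using c(1) in\<Omega> m by (intro weighted_length_ge[OF path w]) (auto simp: S_def)
  then show "m * norm (x - y) \<le> L" using c(1) ends L by (simp add: S_def)
qed

section \<open>Uniform convexity\<close>

lemma modulus_of_convexity_le:
  fixes x y :: "'a::real_normed_vector"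
  assumes "norm x = 1" "norm y = 1"
  shows "modulus_of_convexity TYPE('a) (norm (x - y)) \<le> 1 - norm (x + y) / 2"
  unfolding modulus_of_convexity_def
proof (rule cInf_lower)
  have "0 \<le> 1 - norm (u + v) / 2" if "norm u = 1" "norm v = 1" for u v :: 'a
    using norm_triangle_ineq[of u v] that by simp
  then show "bdd_below {1 - norm (u + v) / 2 |u v :: 'a.
      norm u = 1 \<and> norm v = 1 \<and> norm (u - v) = norm (x - y)}"
    by (intro bdd_belowI[of _ 0]) auto
qed (use assms in auto)

text \<open>The modulus of convexity concerns unit vectors, so a and b are normalized. Each has norm
  at least 1 - 4*\<tau>, hence moves by at most 4*\<tau>, and the normalized sum has norm at least 2
  - 12*\<tau>. This leaves K*d^p \<le> 6*\<tau> for the distance d of the normalized vectors, the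
  origin of 6/K. Normalization costs at most 8*\<tau>; the constant 16 covers this and also the
  trivial bound 2 when \<tau> > 1/8.\<close>

lemma norm_diff_le_of_norm_add_ge:
  fixes a b :: "'a::real_normed_vector"
  assumes p: "2 \<le> p" and K: "0 < K"
    and power_type: "\<And>\<epsilon>. 0 < \<epsilon> \<Longrightarrow> \<epsilon> \<le> 2 \<Longrightarrow> K * \<epsilon> powr p \<le> modulus_of_convexity TYPE('a) \<epsilon>"
    and a: "norm a \<le> 1" and b: "norm b \<le> 1" and \<tau>: "0 \<le> \<tau>" "2 - 4 * \<tau> \<le> norm (a + b)"
  shows "norm (a - b) \<le> ((6 / K) powr (1 / p) + 16) * \<tau> powr (1 / p)"
proof (cases "\<tau> \<le> 1 / 8")
  case False
  have "norm (a - b) \<le> 2" using norm_triangle_ineq4[of a b] a b by simp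
  also have "2 \<le> 16 * ((1 / 8) powr 1 :: real)" by simp
  also have "\<dots> \<le> 16 * (1 / 8) powr (1 / p)"
    using p by (intro mult_left_mono powr_mono') auto
  also have "\<dots> \<le> 16 * \<tau> powr (1 / p)"
    using p False by (intro mult_left_mono powr_mono2) auto
  also have "\<dots> \<le> ((6 / K) powr (1 / p) + 16) * \<tau> powr (1 / p)"
    by (intro mult_right_mono) auto
  finally show ?thesis .
next
  case True
  have ab: "1 - 4 * \<tau> \<le> norm a" "1 - 4 * \<tau> \<le> norm b"
    using norm_triangle_ineq[of a b] a b \<tau> by linarith+
  then have nz: "0 < norm a" "0 < norm b" using True by linarith+
  have near: "norm (sgn v - v) \<le> 4 * \<tau>" if "0 < norm v" "norm v \<le> 1" "1 - 4 * \<tau> \<le> norm v" for v :: 'a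
  proof -
    have "sgn v - v = (1 / norm v - 1) *\<^sub>R v"
      by (simp add: sgn_div_norm algebra_simps divide_inverse)
    then have "norm (sgn v - v) = (1 / norm v - 1) * norm v"
      using that by simp
    also have "\<dots> = 1 - norm v" using that by (simp add: field_simps)
    finally show ?thesis using that by simp
  qed
  let ?d = "norm (sgn a - sgn b)"
  have sgn: "norm (sgn a) = 1" "norm (sgn b) = 1" using nz by (auto simp: norm_sgn)
  have "?d powr p \<le> 6 * \<tau> / K"
  \<comment> \<open>The lower bound on the modulus concerns positive \<epsilon>, so coinciding
    directions are treated separately.\<close>
  proof (cases "?d = 0")
    case True
    then show ?thesis using \<tau> K by simp
  next
    case False
    have "?d \<le> 2" using norm_triangle_ineq4[of "sgn a" "sgn b"] sgn by simp
    then have "K * ?d powr p \<le> 1 - norm (sgn a + sgn b) / 2"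
      using power_type[of ?d] modulus_of_convexity_le[OF sgn] False by fastforce
    moreover have "norm (a + b) \<le> norm (sgn a + sgn b) + norm (sgn a - a) + norm (sgn b - b)"
      using norm_triangle_ineq4[of "sgn a + sgn b" "(sgn a - a) + (sgn b - b)"]
        norm_triangle_ineq[of "sgn a - a" "sgn b - b"] by (simp add: algebra_simps)
    ultimately have "K * ?d powr p \<le> 6 * \<tau>"
      using near[OF nz(1) a ab(1)] near[OF nz(2) b ab(2)] \<tau> by linarith
    then show ?thesis using K by (simp add: field_simps)
  qed
  then have "(?d powr p) powr (1 / p) \<le> (6 * \<tau> / K) powr (1 / p)"
    using p by (intro powr_mono2) auto
  then have d: "?d \<le> (6 / K) powr (1 / p) * \<tau> powr (1 / p)"
    using p K \<tau> by (simp add: powr_powr powr_mult[symmetric])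
  have "\<tau> powr 1 \<le> \<tau> powr (1 / p)"
    using p True \<tau> by (intro powr_mono') auto
  then have "\<tau> \<le> \<tau> powr (1 / p)" using \<tau> by simp
  moreover have "norm (a - b) \<le> ?d + norm (sgn a - a) + norm (sgn b - b)"
    using norm_triangle_ineq4[of "sgn a - sgn b" "(sgn a - a) - (sgn b - b)"]
      norm_triangle_ineq4[of "sgn a - a" "sgn b - b"] by (simp add: algebra_simps)
  ultimately show ?thesis
    using d near[OF nz(1) a ab(1)] near[OF nz(2) b ab(2)] \<tau> by (simp add: algebra_simps)
qed

text \<open>For c \<le> 1/2 write c*a + (1-c)*b = c*(a+b) + (1-2*c)*b. As b lies in the unit ball,
  c*(2 - norm(a+b)) \<le> \<tau>, and c \<ge> 1/4 yields the deficit 4*\<tau> for the midpoint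
  estimate. The case c > 1/2 follows by exchanging a and b.\<close>

lemma norm_diff_le_of_convex_comb_ge:
  fixes a b :: "'a::real_normed_vector"
  assumes p: "2 \<le> p" and K: "0 < K"
    and power_type: "\<And>\<epsilon>. 0 < \<epsilon> \<Longrightarrow> \<epsilon> \<le> 2 \<Longrightarrow> K * \<epsilon> powr p \<le> modulus_of_convexity TYPE('a) \<epsilon>"
    and a: "norm a \<le> 1" and b: "norm b \<le> 1" and "1 / 4 \<le> c" "c \<le> 3 / 4"
    and \<tau>: "0 \<le> \<tau>" "1 - \<tau> \<le> norm (c *\<^sub>R a + (1 - c) *\<^sub>R b)"
  shows "norm (a - b) \<le> ((6 / K) powr (1 / p) + 16) * \<tau> powr (1 / p)"
proof -
  have *: "2 - 4 * \<tau> \<le> norm (a + b)"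
    if "1 / 4 \<le> c" "c \<le> 1 / 2" "norm b \<le> 1" "1 - \<tau> \<le> norm (c *\<^sub>R a + (1 - c) *\<^sub>R b)" for a b :: 'a and c
  proof -
    have "c *\<^sub>R a + (1 - c) *\<^sub>R b = c *\<^sub>R (a + b) + (1 - 2 * c) *\<^sub>R b"
      by (simp add: algebra_simps flip: scaleR_add_left)
    then have "norm (c *\<^sub>R a + (1 - c) *\<^sub>R b) \<le> c * norm (a + b) + (1 - 2 * c) * norm b"
      using norm_triangle_ineq[of "c *\<^sub>R (a + b)" "(1 - 2 * c) *\<^sub>R b"] that by simp
    also have "(1 - 2 * c) * norm b \<le> (1 - 2 * c) * 1"
      using that by (intro mult_left_mono) auto
    finally have "c * (2 - norm (a + b)) \<le> \<tau>" using that by (simp add: algebra_simps)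
    moreover have "1 / 4 * (2 - norm (a + b)) \<le> c * (2 - norm (a + b))" if "norm (a + b) \<le> 2"
      using that \<open>1 / 4 \<le> c\<close> by (intro mult_right_mono) auto
    ultimately show ?thesis using \<tau> by argo
  qed
  have "2 - 4 * \<tau> \<le> norm (a + b)"
  proof (cases "c \<le> 1 / 2")
    case True
    then show ?thesis using *[of c b a] assms by simp
  next
    case False
    then show ?thesis using *[of "1 - c" a b] assms by (simp add: add.commute)
  qed
  then show ?thesis using norm_diff_le_of_norm_add_ge[OF p K power_type a b \<tau>(1)] by blast
qed

section \<open>The limsup condition\<close>

lemma modulus_of_continuity_mono: "s \<le> t \<Longrightarrow> modulus_of_continuity \<Omega> w s \<le> modulus_of_continuity \<Omega> w t"
  unfolding modulus_of_continuity_def by (intro Sup_subset_mono) force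

text \<open>Superlevel sets of a monotone function are intervals.\<close>

lemma borel_measurable_mono_ennreal:
  fixes f :: "real \<Rightarrow> ennreal"
  assumes "\<And>s t. s \<le> t \<Longrightarrow> f s \<le> f t"
  shows "f \<in> borel_measurable borel"
proof (rule borel_measurableI_greater)
  fix y
  have "is_interval {x. y < f x}"
    unfolding is_interval_1 using assms by (auto intro: less_le_trans)
  then show "{x \<in> space borel. y < f x} \<in> sets borel"
    using real_interval_borel_measurable by simp
qed

text \<open>The majorant is a multiple of \<open>\<integral>\<^sub>0\<^sup>s \<nu>(t)/t dt\<close>. This integral dominates \<open>\<nu>(s/4)\<close> because of
  its part over \<open>[s/4, s)\<close>; together with the limsup condition, this makes it decay
  geometrically.\<close>

lemma finite_limsup_condition_geometric_majorant:
  assumes lim: "finite_limsup_condition \<nu>" and mono: "\<And>s t. s \<le> t \<Longrightarrow> \<nu> s \<le> \<nu> t"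
  obtains s1 \<theta> \<psi> where "0 < s1" "0 < \<theta>" "\<theta> < 1"
    "\<forall>s. 0 < s \<and> s < s1 \<longrightarrow> 0 \<le> \<psi> s \<and> \<nu> s \<le> ennreal (\<psi> s) \<and> \<psi> (s / 4) \<le> \<theta> * \<psi> s"
    "\<forall>s t. 0 < s \<and> s \<le> t \<and> t < s1 \<longrightarrow> \<psi> s \<le> \<psi> t"
proof -
  obtain C s0 where C: "C < \<infinity>" "0 < s0"
    and fin: "\<And>s. 0 < s \<Longrightarrow> s < s0 \<Longrightarrow> \<nu> s < \<infinity>"
    and le: "\<And>s. 0 < s \<Longrightarrow> s < s0 \<Longrightarrow> (\<integral>\<^sup>+t\<in>{0<..<s}. \<nu> t / ennreal t \<partial>lborel) \<le> C * \<nu> s"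
    using lim unfolding finite_limsup_condition_def by blast
  have [measurable]: "\<nu> \<in> borel_measurable borel"
    by (rule borel_measurable_mono_ennreal[OF mono])
  define G where "G s = (\<integral>\<^sup>+t\<in>{0<..<s}. \<nu> t / ennreal t \<partial>lborel)" for s
  define g where "g s = enn2real (G s)" for s
  \<comment> \<open>The maximum with 1 keeps c, and with it \<theta>, positive even if C =
    0.\<close>
  define c where "c = max 1 (enn2real C)"
  have Gfin: "G s < \<infinity>" if "0 < s" "s < s0" for s
    using le[OF that] fin[OF that] C by (simp add: G_def ennreal_mult_less_top order_le_less_trans)
  have G_mono: "G s \<le> G t" if "s \<le> t" for s t
    unfolding G_def using that by (intro nn_integral_mono) (auto simp: indicator_def)
  \<comment> \<open>On [s/4, s) the integrand is at least \<nu>(s/4)/s, and this interval has length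
    3*s/4.\<close>
  have G_step: "G (s / 4) + ennreal (3 / 4) * \<nu> (s / 4) \<le> G s" if s: "0 < s" for s
  proof -
    have "ennreal (3 / 4) * \<nu> (s / 4) = \<nu> (s / 4) / ennreal s * emeasure lborel {s / 4..<s}"
    proof -
      have "ennreal (3 / 4) = ennreal (inverse s) * ennreal (s * 3 / 4)"
        using s by (simp add: ennreal_mult'[symmetric] field_simps)
      then show ?thesis
        using s by (simp add: divide_ennreal_def inverse_ennreal mult_ac)
    qed
    also have "\<dots> = (\<integral>\<^sup>+t\<in>{s / 4..<s}. \<nu> (s / 4) / ennreal s \<partial>lborel)"
      by (simp add: nn_integral_cmult_indicator)
    finally have "G (s / 4) + ennreal (3 / 4) * \<nu> (s / 4)
      = (\<integral>\<^sup>+t. \<nu> t / ennreal t * indicator {0<..<s / 4} t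
          + \<nu> (s / 4) / ennreal s * indicator {s / 4..<s} t \<partial>lborel)"
      unfolding G_def by (subst nn_integral_add) auto
    also have "\<dots> \<le> G s"
      unfolding G_def
    proof (intro nn_integral_mono)
      fix t
      have "\<nu> (s / 4) / ennreal s \<le> \<nu> t / ennreal t" if "s / 4 \<le> t" "t < s"
        using that s mono by (auto simp: divide_ennreal_def inverse_ennreal
            intro!: mult_mono mono ennreal_leI le_imp_inverse_le)
      then show "\<nu> t / ennreal t * indicator {0<..<s / 4} t
          + \<nu> (s / 4) / ennreal s * indicator {s / 4..<s} t \<le> \<nu> t / ennreal t * indicator {0<..<s} t"
        using s by (auto simp: indicator_def)
    qed
    finally show ?thesis .
  qed
  have g_eq: "ennreal (g s) = G s" if "0 < s" "s < s0" for s
    using Gfin[OF that] by (simp add: g_def)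
  have g_nonneg: "0 \<le> g s" for s by (simp add: g_def)
  define n where "n s = enn2real (\<nu> s)" for s
  have n_eq: "ennreal (n s) = \<nu> s" if "0 < s" "s < s0" for s
    using fin[OF that] by (simp add: n_def)
  have n_nonneg: "0 \<le> n s" for s by (simp add: n_def)
  have step: "g (s / 4) + 3 / 4 * n (s / 4) \<le> g s" if "0 < s" "s < s0" for s
  proof -
    have "ennreal (g (s / 4) + 3 / 4 * n (s / 4)) \<le> ennreal (g s)"
      using G_step[OF that(1)] that g_nonneg n_nonneg
      by (simp add: g_eq[symmetric] n_eq[symmetric] ennreal_mult'[symmetric] ennreal_plus[symmetric]
            del: ennreal_plus)
    then show ?thesis using g_nonneg by (simp add: ennreal_le_iff)
  qed
  have g_le: "g s \<le> c * n s" if "0 < s" "s < s0" for s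
  proof -
    have "ennreal (g s) \<le> C * \<nu> s"
      using le[OF that] by (simp add: g_eq[OF that]) (simp add: G_def)
    also have "C = ennreal (enn2real C)" using C by simp
    also have "ennreal (enn2real C) * \<nu> s = ennreal (enn2real C * n s)"
      by (simp add: n_eq[OF that, symmetric] ennreal_mult' n_nonneg)
    also have "\<dots> \<le> ennreal (c * n s)"
      by (intro ennreal_leI mult_right_mono n_nonneg) (simp add: c_def)
    finally show ?thesis using n_nonneg by (simp add: ennreal_le_iff c_def)
  qed
  have c: "1 \<le> c" by (simp add: c_def)
  \<comment> \<open>Combining g(s/4) + 3/4 * n(s/4) \<le> g(s) with n(s/4) \<ge> g(s/4)/c gives (1 +
    3/(4*c)) * g(s/4) \<le> g(s); \<theta> is the inverse of this factor.\<close>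
  define \<theta> where "\<theta> = 4 * c / (4 * c + 3)"
  have decay: "g (s / 4) \<le> \<theta> * g s" if "0 < s" "s < s0" for s
  proof -
    have "c * (g (s / 4) + 3 / 4 * n (s / 4)) \<le> c * g s"
      using step[OF that] c by (intro mult_left_mono) auto
    then have "c * g (s / 4) + 3 / 4 * g (s / 4) \<le> c * g s"
      using g_le[of "s / 4"] that by (simp add: algebra_simps)
    then show ?thesis using c by (simp add: \<theta>_def field_simps)
  qed
  show thesis
  \<comment> \<open>The inequality \<open>step\<close> at 4*s reads 3/4 * n(s) \<le> g(4*s) up to a
    nonnegative term. This explains the factor 4/3, the argument 4*s and the smaller range
    s0/4.\<close>
  proof (rule that[of "s0 / 4" \<theta> "\<lambda>s. 4 / 3 * g (4 * s)"]; (intro allI impI conjI)?)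
    show "0 < s0 / 4" "0 < \<theta>" "\<theta> < 1" using C c by (auto simp: \<theta>_def field_simps)
  next
    fix s assume s: "0 < s \<and> s < s0 / 4"
    show "0 \<le> 4 / 3 * g (4 * s)" using g_nonneg by simp
    show "\<nu> s \<le> ennreal (4 / 3 * g (4 * s))"
      using step[of "4 * s"] s g_nonneg[of s] by (subst n_eq[symmetric]) (auto intro!: ennreal_leI)
    show "4 / 3 * g (4 * (s / 4)) \<le> \<theta> * (4 / 3 * g (4 * s))"
      using decay[of "4 * s"] s by simp
  next
    fix s t assume "0 < s \<and> s \<le> t \<and> t < s0 / 4"
    then show "4 / 3 * g (4 * s) \<le> 4 / 3 * g (4 * t)"
      using G_mono[of "4 * s" "4 * t"] Gfin[of "4 * t"] by (simp add: g_def enn2real_mono)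
  qed
qed

section \<open>Difference quotients\<close>

definition diff_quotient :: "(real \<Rightarrow> 'a::real_normed_vector) \<Rightarrow> real \<Rightarrow> real \<Rightarrow> 'a" where
  "diff_quotient f u v = (f v - f u) /\<^sub>R (v - u)"

lemma diff_quotient_commute: "diff_quotient f u v = diff_quotient f v u"
proof -
  have "f v - f u = - (f u - f v)" "v - u = - (u - v)" by auto
  then show ?thesis unfolding diff_quotient_def
    by (metis inverse_minus_eq scaleR_minus_left scaleR_minus_right minus_minus)
qed

text \<open>Completeness provides the derivative D as a limit of quotients, at a rate independent of
  u. Since the quotient is symmetric in its two points, it is close to both D u and D v, which makes
  D continuous.\<close>

lemma C1_differentiable_on_of_uniformly_Cauchy:
  fixes f :: "real \<Rightarrow> 'a::banach"
  assumes "open J"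
    and Cauchy: "\<And>e. 0 < e \<Longrightarrow> \<exists>d>0. \<forall>u\<in>J. \<forall>v\<in>J. \<forall>v'\<in>J. v \<noteq> u \<and> v' \<noteq> u \<and>
      \<bar>v - u\<bar> < d \<and> \<bar>v' - u\<bar> < d \<longrightarrow> norm (diff_quotient f u v - diff_quotient f u v') \<le> e"
  shows "f C1_differentiable_on J"
proof -
  define Q where "Q u e d \<longleftrightarrow> (\<forall>v\<in>J. \<forall>v'\<in>J. v \<noteq> u \<and> v' \<noteq> u \<and>
      \<bar>v - u\<bar> < d \<and> \<bar>v' - u\<bar> < d \<longrightarrow> norm (diff_quotient f u v - diff_quotient f u v') \<le> e)" for u e d
  have QE: "norm (diff_quotient f u v - diff_quotient f u v') \<le> e"
    if "Q u e d" "v \<in> J" "v' \<in> J" "v \<noteq> u" "v' \<noteq> u" "\<bar>v - u\<bar> < d" "\<bar>v' - u\<bar> < d" for u e d v v'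
    using that unfolding Q_def by blast
  have Q: "\<exists>d>0. \<forall>u\<in>J. Q u e d" if "0 < e" for e
    using Cauchy[OF that] unfolding Q_def .
  \<comment> \<open>The limit L has to be chosen before e and d. Quantifying over every d that
    satisfies Q for e allows the d that is uniform in u to be inserted after D has been
    chosen.\<close>
  have "\<exists>L. \<forall>e>0. \<forall>d>0. Q u e d \<longrightarrow>
      (\<forall>v\<in>J. v \<noteq> u \<and> \<bar>v - u\<bar> < d \<longrightarrow> norm (diff_quotient f u v - L) \<le> e)" if u: "u \<in> J" for u
  proof -
    obtain r where r: "r > 0" "ball u r \<subseteq> J" using \<open>open J\<close> u openE by blast
    \<comment> \<open>The denominator n + 2 keeps the offset positive and at most r/2, hence inside
      the ball.\<close>
    define X where "X n = u + r / real (n + 2)" for n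
    have X: "X n \<in> J" "X n \<noteq> u" for n
      using r(1) r(2) by (auto simp: X_def dist_real_def field_simps add_pos_nonneg intro!: subsetD[OF r(2)])
    have "(\<lambda>n. r / real (n + 2)) \<longlonglongrightarrow> 0"
      by (rule LIMSEQ_ignore_initial_segment[OF lim_const_over_n])
    then have near: "\<exists>N. \<forall>n\<ge>N. \<bar>X n - u\<bar> < d" if "d > 0" for d
      using that unfolding LIMSEQ_iff X_def by simp
    have "Cauchy (\<lambda>n. diff_quotient f u (X n))"
    proof (rule CauchyI)
      fix e :: real assume "0 < e"
      then obtain d where d: "d > 0" "Q u (e / 2) d"
        using Q[of "e / 2"] u by auto
      obtain N where N: "\<And>n. n \<ge> N \<Longrightarrow> \<bar>X n - u\<bar> < d" using near[OF d(1)] by blast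
      have "norm (diff_quotient f u (X m) - diff_quotient f u (X n)) < e" if "m \<ge> N" "n \<ge> N" for m n
        using QE[OF d(2) X(1) X(1) X(2) X(2) N[OF that(1)] N[OF that(2)]] \<open>0 < e\<close> by linarith
      then show "\<exists>M. \<forall>m\<ge>M. \<forall>n\<ge>M. norm (diff_quotient f u (X m) - diff_quotient f u (X n)) < e"
        by blast
    qed
    then obtain L where L: "(\<lambda>n. diff_quotient f u (X n)) \<longlonglongrightarrow> L"
      using Cauchy_convergent convergent_def by blast
    show ?thesis
    proof (intro exI[of _ L] allI impI ballI)
      fix e d :: real and v
      assume e: "0 < e" "0 < d" and *: "Q u e d"
        and v: "v \<in> J" "v \<noteq> u \<and> \<bar>v - u\<bar> < d"
      obtain N where N: "\<And>n. n \<ge> N \<Longrightarrow> \<bar>X n - u\<bar> < d" using near[OF e(2)] by blast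
      have "(\<lambda>n. norm (diff_quotient f u v - diff_quotient f u (X n))) \<longlonglongrightarrow> norm (diff_quotient f u v - L)"
        by (intro tendsto_intros L)
      then show "norm (diff_quotient f u v - L) \<le> e"
      proof (rule LIMSEQ_le_const2)
        show "\<exists>N. \<forall>n\<ge>N. norm (diff_quotient f u v - diff_quotient f u (X n)) \<le> e"
          using QE[OF * v(1) X(1) _ X(2) _ N] v by blast
      qed
    qed
  qed
  then have "\<forall>u\<in>J. \<exists>L. \<forall>e>0. \<forall>d>0. Q u e d \<longrightarrow>
      (\<forall>v\<in>J. v \<noteq> u \<and> \<bar>v - u\<bar> < d \<longrightarrow> norm (diff_quotient f u v - L) \<le> e)" ..
  from bchoice[OF this] obtain D where D: "\<forall>u\<in>J. \<forall>e>0. \<forall>d>0. Q u e d \<longrightarrow>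
      (\<forall>v\<in>J. v \<noteq> u \<and> \<bar>v - u\<bar> < d \<longrightarrow> norm (diff_quotient f u v - D u) \<le> e)"
    by (elim exE)
  have unif: "\<exists>d>0. \<forall>u\<in>J. \<forall>v\<in>J. v \<noteq> u \<and> \<bar>v - u\<bar> < d \<longrightarrow> norm (diff_quotient f u v - D u) \<le> e"
    if e: "0 < e" for e
  proof -
    obtain d where "d > 0" "\<forall>u\<in>J. Q u e d" using Q[OF e] by blast
    then show ?thesis using D e by blast
  qed
  show ?thesis
    unfolding C1_differentiable_on_def
  proof (intro exI[of _ D] conjI ballI)
    fix u assume u: "u \<in> J"
    obtain r where r: "r > 0" "ball u r \<subseteq> J" using \<open>open J\<close> u openE by blast
    show "(f has_vector_derivative D u) (at u)"
      unfolding has_vector_derivative_def has_derivative_at_alt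
    proof (intro conjI allI impI)
      show "bounded_linear (\<lambda>x. x *\<^sub>R D u)" by (rule bounded_linear_scaleR_left)
      fix e :: real assume "0 < e"
      from unif[OF this] obtain d where d0: "d > 0"
        "\<forall>u\<in>J. \<forall>v\<in>J. v \<noteq> u \<and> \<bar>v - u\<bar> < d \<longrightarrow> norm (diff_quotient f u v - D u) \<le> e"
        by (elim exE conjE)
      then have d: "norm (diff_quotient f u v - D u) \<le> e"
        if "v \<in> J" "v \<noteq> u" "\<bar>v - u\<bar> < d" for v
        using u that by simp
      have "norm (f v - f u - (v - u) *\<^sub>R D u) \<le> e * norm (v - u)" if v: "norm (v - u) < min d r" for v
      proof (cases "v = u")
        case False
        have "f v - f u - (v - u) *\<^sub>R D u = (v - u) *\<^sub>R (diff_quotient f u v - D u)"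
          using False by (simp add: diff_quotient_def scaleR_diff_right)
        moreover have "norm (diff_quotient f u v - D u) \<le> e"
          using v False r by (intro d) (auto simp: dist_real_def)
        ultimately show ?thesis by (simp add: mult.commute[of e] mult_left_mono)
      qed simp
      then show "\<exists>d>0. \<forall>y. norm (y - u) < d \<longrightarrow> norm (f y - f u - (y - u) *\<^sub>R D u) \<le> e * norm (y - u)"
        using d0(1) r by (intro exI[of _ "min d r"]) auto
    qed
  next
    show "continuous_on J D"
      unfolding continuous_on_iff
    proof (intro ballI allI impI)
      fix u and e :: real assume "u \<in> J" "0 < e"
      then have "0 < e / 3" by simp
      from unif[OF this] obtain d where d0: "d > 0"
        "\<forall>u\<in>J. \<forall>v\<in>J. v \<noteq> u \<and> \<bar>v - u\<bar> < d \<longrightarrow> norm (diff_quotient f u v - D u) \<le> e / 3"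
        by (elim exE conjE)
      then have d: "norm (diff_quotient f u v - D u) \<le> e / 3"
        if "u \<in> J" "v \<in> J" "v \<noteq> u" "\<bar>v - u\<bar> < d" for u v
        using that by simp
      have "dist (D v) (D u) < e" if v: "v \<in> J" "dist v u < d" for v
      proof (cases "v = u")
        case False
        have "norm (D v - D u) \<le> norm (diff_quotient f u v - D u) + norm (diff_quotient f v u - D v)"
          using norm_triangle_ineq4[of "diff_quotient f u v - D u" "diff_quotient f v u - D v"]
          by (simp add: diff_quotient_commute[of f v u])
        then show ?thesis
          using d[of u v] d[of v u] v False \<open>u \<in> J\<close> \<open>0 < e\<close> by (simp add: dist_norm abs_minus_commute)
      qed (use \<open>0 < e\<close> in simp)
      then show "\<exists>d>0. \<forall>x'\<in>J. dist x' u < d \<longrightarrow> dist (D x') (D u) < e" using d0(1) by blast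
    qed
  qed
qed

text \<open>Permits the constants of the main estimate to depend on the point of the
  geodesic.\<close>

lemma C1_differentiable_on_locally:
  assumes "\<And>t. t \<in> S \<Longrightarrow> \<exists>J. open J \<and> t \<in> J \<and> f C1_differentiable_on J"
  shows "f C1_differentiable_on S"
  unfolding C1_differentiable_on_eq continuous_on_eq_continuous_within
proof (intro conjI ballI)
  fix t assume "t \<in> S"
  then obtain J where J: "open J" "t \<in> J" "f C1_differentiable_on J" using assms by blast
  then show "f differentiable at t" by (simp add: C1_differentiable_on_eq)
  have "continuous (at t) (\<lambda>x. vector_derivative f (at x))"
    using J by (simp add: C1_differentiable_on_eq continuous_on_eq_continuous_at)
  then show "continuous (at t within S) (\<lambda>x. vector_derivative f (at x))"
    by (rule continuous_at_imp_continuous_at_within)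
qed

section \<open>Comparison of difference quotients across scales\<close>

text \<open>Quartering h repeatedly gives errors dominated by a geometric series. The constant B =
  2/(1-\<theta>) satisfies B*\<theta> + 2 = B, which closes the induction, and B \<ge> 2, which pays
  for two steps when c \<ge> 3/4. The condition 0 < h/h0 keeps h on the side of h0, so both signs
  are handled at once.\<close>

lemma geometric_chain:
  fixes q :: "real \<Rightarrow> 'a::real_normed_vector"
  assumes step: "\<And>h c. h \<noteq> 0 \<Longrightarrow> \<bar>h\<bar> \<le> \<bar>h0\<bar> \<Longrightarrow> 0 < h / h0 \<Longrightarrow> 1 / 4 \<le> c \<Longrightarrow> c \<le> 3 / 4 \<Longrightarrow>
      norm (q h - q (c * h)) \<le> \<phi> \<bar>h\<bar>"
    and mono: "\<And>s t. 0 < s \<Longrightarrow> s \<le> t \<Longrightarrow> t \<le> \<bar>h0\<bar> \<Longrightarrow> \<phi> s \<le> \<phi> t"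
    and decay: "\<And>s. 0 < s \<Longrightarrow> s \<le> \<bar>h0\<bar> \<Longrightarrow> \<phi> (s / 4) \<le> \<theta> * \<phi> s"
    and \<theta>: "0 < \<theta>" "\<theta> < 1" and h0: "h0 \<noteq> 0" and c: "0 < c" "c \<le> 1"
  shows "norm (q h0 - q (c * h0)) \<le> 2 / (1 - \<theta>) * \<phi> \<bar>h0\<bar>"
proof -
  have nonneg: "0 \<le> \<phi> s" if "0 < s" "s \<le> \<bar>h0\<bar>" for s
  proof -
    \<comment> \<open>A value of \<phi> is nonnegative because, by \<open>step\<close>, it bounds a
      norm; h is the number of modulus s with the sign of h0.\<close>
    define h where "h = (if 0 < h0 then s else - s)"
    have "norm (q h - q (1/2 * h)) \<le> \<phi> \<bar>h\<bar>"
      using that h0 by (intro step) (auto simp: h_def zero_less_divide_iff)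
    moreover have "\<bar>h\<bar> = s" using that by (simp add: h_def)
    ultimately show ?thesis using norm_ge_zero order_trans by metis
  qed
  \<comment> \<open>The exponent k bounds the number of quarterings; c*h is rewritten as (4*c)*(h/4)
    in the recursive case.\<close>
  have "norm (q h - q (c * h)) \<le> 2 / (1 - \<theta>) * \<phi> \<bar>h\<bar>"
    if "h \<noteq> 0" "\<bar>h\<bar> \<le> \<bar>h0\<bar>" "0 < h / h0" "1 / 4 ^ k \<le> c" "c \<le> 1" for k h c
    using that
  proof (induction k arbitrary: h c)
    case 0
    then show ?case using nonneg[of "\<bar>h\<bar>"] \<theta> by simp
  next
    case (Suc k)
    have \<phi>0: "0 \<le> \<phi> \<bar>h\<bar>" using nonneg[of "\<bar>h\<bar>"] Suc.prems by simp
    consider "c \<le> 1 / 4" | "1 / 4 \<le> c" "c \<le> 3 / 4" | "3 / 4 \<le> c" by linarith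
    then show ?case
    proof cases
      case 1
      have "norm (q (h / 4) - q (c * h)) \<le> 2 / (1 - \<theta>) * \<phi> (\<bar>h\<bar> / 4)"
        using Suc.IH[of "h / 4" "4 * c"] Suc.prems 1 by (simp add: field_simps)
      also have "\<dots> \<le> 2 / (1 - \<theta>) * (\<theta> * \<phi> \<bar>h\<bar>)"
        using decay[of "\<bar>h\<bar>"] Suc.prems \<theta> by (intro mult_left_mono) auto
      finally have "norm (q (h / 4) - q (c * h)) \<le> 2 / (1 - \<theta>) * \<theta> * \<phi> \<bar>h\<bar>" by simp
      moreover have "norm (q h - q (h / 4)) \<le> \<phi> \<bar>h\<bar>"
        using step[of h "1/4"] Suc.prems by simp
      moreover have "norm (q h - q (c * h)) \<le> norm (q h - q (h / 4)) + norm (q (h / 4) - q (c * h))"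
        using norm_triangle_ineq[of "q h - q (h / 4)" "q (h / 4) - q (c * h)"] by simp
      moreover have "2 / (1 - \<theta>) * \<theta> * \<phi> \<bar>h\<bar> + \<phi> \<bar>h\<bar> \<le> 2 / (1 - \<theta>) * \<phi> \<bar>h\<bar>"
      proof -
        have "2 / (1 - \<theta>) * \<phi> \<bar>h\<bar> - 2 / (1 - \<theta>) * \<theta> * \<phi> \<bar>h\<bar> = 2 * \<phi> \<bar>h\<bar>"
        proof -
          have "a * x - a * \<theta> * x = a * (1 - \<theta>) * x" for a x
            by (simp add: algebra_simps)
          moreover have "2 / (1 - \<theta>) * (1 - \<theta>) = 2" using \<theta> by (simp add: field_simps)
          ultimately show ?thesis by (simp only:)
        qed
        then show ?thesis using \<phi>0 by linarith
      qed
      ultimately show ?thesis by linarith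
    next
      case 2
      have "1 * \<phi> \<bar>h\<bar> \<le> 2 / (1 - \<theta>) * \<phi> \<bar>h\<bar>"
        using \<phi>0 \<theta> by (intro mult_right_mono) (auto simp: field_simps)
      then show ?thesis using step[of h c] Suc.prems 2 by simp
    next
      case 3
      \<comment> \<open>The ratio c is too close to 1 for a single step. Both h and c*h are compared
        with h/2, where 1/(2*c) lies between 1/2 and 2/3.\<close>
      have "0 < c" using 3 by simp
      have "norm (q h - q (h / 2)) \<le> \<phi> \<bar>h\<bar>"
        using step[of h "1/2"] Suc.prems by simp
      moreover have "norm (q (c * h) - q (h / 2)) \<le> \<phi> \<bar>c * h\<bar>"
      proof -
        have le: "c * \<bar>h\<bar> \<le> \<bar>h\<bar>" using Suc.prems \<open>0 < c\<close> by (intro mult_left_le_one_le) auto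
        have "\<bar>c * h\<bar> \<le> \<bar>h0\<bar>"
          using order_trans[OF le Suc.prems(2)] \<open>0 < c\<close> by (simp add: abs_mult)
        moreover have "0 < c * h / h0"
          using mult_pos_pos[OF \<open>0 < c\<close> Suc.prems(3)] by simp
        moreover have "1 / 4 \<le> 1 / (2 * c)" "1 / (2 * c) \<le> 3 / 4" "1 / (2 * c) * (c * h) = h / 2"
          using Suc.prems 3 \<open>0 < c\<close> by (auto simp: field_simps)
        ultimately show ?thesis using step[of "c * h" "1 / (2 * c)"] Suc.prems(1) \<open>0 < c\<close> by simp
      qed
      moreover have "\<phi> \<bar>c * h\<bar> \<le> \<phi> \<bar>h\<bar>"
        using Suc.prems \<open>0 < c\<close> by (intro mono) (auto simp: abs_mult mult_left_le_one_le)
      moreover have "norm (q h - q (c * h)) \<le> norm (q h - q (h / 2)) + norm (q (c * h) - q (h / 2))"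
        using norm_triangle_ineq4[of "q h - q (h / 2)" "q (c * h) - q (h / 2)"] by simp
      moreover have "2 * \<phi> \<bar>h\<bar> \<le> 2 / (1 - \<theta>) * \<phi> \<bar>h\<bar>"
        using \<phi>0 \<theta> by (intro mult_right_mono) (auto simp: field_simps)
      ultimately show ?thesis by linarith
    qed
  qed
  note chain = this
  obtain k where "(1 / 4) ^ k < c"
    using real_arch_pow_inv[of c "1/4"] c by auto
  then show ?thesis
    using chain[of h0 k c] h0 c by (simp add: power_divide)
qed

lemma geometric_decay_iterate:
  fixes \<phi> :: "real \<Rightarrow> real"
  assumes decay: "\<And>s. 0 < s \<Longrightarrow> s < b \<Longrightarrow> \<phi> (s / 4) \<le> \<theta> * \<phi> s" and "0 < \<theta>" "0 < s" "s < b"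
  shows "\<phi> (s / 4 ^ k) \<le> \<theta> ^ k * \<phi> s"
proof (induction k)
  case (Suc k)
  have "s / 4 ^ k \<le> s" using \<open>0 < s\<close> by (simp add: field_simps)
  then have "\<phi> (s / 4 ^ k / 4) \<le> \<theta> * \<phi> (s / 4 ^ k)"
    using assms by (intro decay) auto
  also have "\<dots> \<le> \<theta> * (\<theta> ^ k * \<phi> s)" using Suc \<open>0 < \<theta>\<close> by (intro mult_left_mono) auto
  finally show ?case by (simp add: mult_ac)
qed simp

lemma geometric_decay_small:
  fixes \<phi> :: "real \<Rightarrow> real"
  assumes decay: "\<And>s. 0 < s \<Longrightarrow> s < b \<Longrightarrow> \<phi> (s / 4) \<le> \<theta> * \<phi> s" and "0 < \<theta>" "\<theta> < 1" "0 < b" "0 < e"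
  obtains s where "0 < s" "s < b" "\<phi> s \<le> e"
proof -
  have "(\<lambda>k. \<theta> ^ k * \<phi> (b / 2)) \<longlonglongrightarrow> 0 * \<phi> (b / 2)"
    using assms by (intro tendsto_intros LIMSEQ_realpow_zero) auto
  then have "\<forall>\<^sub>F k in sequentially. \<theta> ^ k * \<phi> (b / 2) < e"
    using \<open>0 < e\<close> by (simp add: order_tendsto_iff)
  then obtain k where k: "\<theta> ^ k * \<phi> (b / 2) < e" by (meson eventually_sequentially order_refl)
  show thesis
  proof
    show "\<phi> (b / 2 / 4 ^ k) \<le> e"
      using geometric_decay_iterate[of b \<phi> \<theta> "b / 2" k] assms k by force
    show "0 < b / 2 / 4 ^ k" using \<open>0 < b\<close> by simp
    have "b / 2 / 4 ^ k \<le> b / 2" using \<open>0 < b\<close> by (simp add: field_simps)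
    then show "b / 2 / 4 ^ k < b" using \<open>0 < b\<close> by linarith
  qed
qed

lemma diff_quotient_convex_comb:
  assumes "s < u" "u < t"
  shows "diff_quotient f s t
    = ((u - s) / (t - s)) *\<^sub>R diff_quotient f s u + ((t - u) / (t - s)) *\<^sub>R diff_quotient f u t"
proof -
  have eqs: "((u - s) / (t - s)) *\<^sub>R diff_quotient f s u = (f u - f s) /\<^sub>R (t - s)"
    "((t - u) / (t - s)) *\<^sub>R diff_quotient f u t = (f t - f u) /\<^sub>R (t - s)"
    using assms by (simp_all add: diff_quotient_def divide_inverse)
  show ?thesis unfolding eqs by (simp add: diff_quotient_def flip: scaleR_add_right)
qed

text \<open>A quotient over [s, t] is a convex combination of those over [s, u] and [u, t]. Hence
  quotients with a common base point differ by a multiple, of factor at most 1, of the difference of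
  adjacent quotients, and \<open>geometric_chain\<close> applies on each side of the base point. The
  midpoint case of the hypothesis links the two sides.\<close>

lemma C1_differentiable_on_of_three_points:
  fixes f :: "real \<Rightarrow> 'a::banach"
  assumes three: "\<And>s u t. a < s \<Longrightarrow> s < u \<Longrightarrow> u < t \<Longrightarrow> t < b \<Longrightarrow>
      1 / 4 \<le> (u - s) / (t - s) \<Longrightarrow> (u - s) / (t - s) \<le> 3 / 4 \<Longrightarrow>
      norm (diff_quotient f s u - diff_quotient f u t) \<le> \<phi> (t - s)"
    and mono: "\<And>s t. 0 < s \<Longrightarrow> s \<le> t \<Longrightarrow> t < b - a \<Longrightarrow> \<phi> s \<le> \<phi> t"
    and decay: "\<And>s. 0 < s \<Longrightarrow> s < b - a \<Longrightarrow> \<phi> (s / 4) \<le> \<theta> * \<phi> s"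
    and \<theta>: "0 < \<theta>" "\<theta> < 1"
  shows "f C1_differentiable_on {a<..<b}"
proof (cases "a < b")
  case False
  then show ?thesis by (simp add: C1_differentiable_on_def)
next
  case True
  have step: "norm (diff_quotient f u (u + h) - diff_quotient f u (u + c * h)) \<le> \<phi> \<bar>h\<bar>"
    if uh: "a < u" "u < b" "a < u + h" "u + h < b" "h \<noteq> 0" and c: "1 / 4 \<le> c" "c \<le> 3 / 4" for u h c
  proof (cases "0 < h")
    case True
    have ch: "0 < c * h" "c * h < h" using True c by (auto intro: mult_pos_pos)
    have "norm (diff_quotient f u (u + c * h) - diff_quotient f (u + c * h) (u + h)) \<le> \<phi> (u + h - u)"
      using uh ch c True by (intro three) auto
    moreover have "diff_quotient f u (u + h) - diff_quotient f u (u + c * h)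
        = (c - 1) *\<^sub>R (diff_quotient f u (u + c * h) - diff_quotient f (u + c * h) (u + h))"
    proof -
      have eqs: "(u + c * h - u) / (u + h - u) = c" "(u + h - (u + c * h)) / (u + h - u) = 1 - c"
        using True by (simp_all add: field_simps)
      have "diff_quotient f u (u + h)
          = c *\<^sub>R diff_quotient f u (u + c * h) + (1 - c) *\<^sub>R diff_quotient f (u + c * h) (u + h)"
        using diff_quotient_convex_comb[of u "u + c * h" "u + h" f, unfolded eqs] ch by simp
      then show ?thesis by (simp add: algebra_simps)
    qed
    moreover have "\<bar>c - 1\<bar> * y \<le> y" if "0 \<le> y" for y
      using that c by (intro mult_left_le_one_le) auto
    ultimately show ?thesis using True by (smt (verit) norm_ge_zero norm_scaleR)
  next
    case False
    then have "0 < - h" using uh by simp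
    have ch: "0 < c * - h" "c * - h < - h" 
      using \<open>0 < - h\<close> c mult_strict_right_mono[of c 1 "- h"] by (auto simp: mult_pos_neg)
    \<comment> \<open>For negative h the base point is the right end, which turns the ratio c into 1
      - c; the range [1/4, 3/4] is invariant under this.\<close>
    have ratio: "(u + c * h - (u + h)) / (u - (u + h)) = 1 - c"
      using \<open>0 < - h\<close> by (simp add: field_simps)
    have "norm (diff_quotient f (u + h) (u + c * h) - diff_quotient f (u + c * h) u) \<le> \<phi> (u - (u + h))"
      using uh ch c unfolding ratio by (intro three; (subst ratio)?) auto
    moreover have "diff_quotient f (u + h) u - diff_quotient f (u + c * h) u
        = (1 - c) *\<^sub>R (diff_quotient f (u + h) (u + c * h) - diff_quotient f (u + c * h) u)"
    proof -
      have eq: "(u - (u + c * h)) / (u - (u + h)) = c" using \<open>0 < - h\<close> by simp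
      have "diff_quotient f (u + h) u
          = (1 - c) *\<^sub>R diff_quotient f (u + h) (u + c * h) + c *\<^sub>R diff_quotient f (u + c * h) u"
        by (rule diff_quotient_convex_comb[of "u + h" "u + c * h" u f, unfolded eq ratio]) (use ch in simp_all)
      then show ?thesis by (simp add: algebra_simps)
    qed
    moreover have "\<bar>1 - c\<bar> * y \<le> y" if "0 \<le> y" for y
      using that c by (intro mult_left_le_one_le) auto
    ultimately show ?thesis
      using \<open>0 < - h\<close> by (smt (verit) norm_ge_zero norm_scaleR diff_quotient_commute)
  qed
  have nonneg: "0 \<le> \<phi> s" if "0 < s" "s < b - a" for s
  proof -
    \<comment> \<open>Centres [u, u + s] in (a, b), so that \<open>step\<close> applies to
      it.\<close>
    define u where "u = (a + b - s) / 2"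
    have "norm (diff_quotient f u (u + s) - diff_quotient f u (u + 1/2 * s)) \<le> \<phi> \<bar>s\<bar>"
      using that by (intro step) (auto simp: u_def field_simps)
    then show ?thesis using that by (smt (verit) norm_ge_zero)
  qed
  have chain: "norm (diff_quotient f u (u + h) - diff_quotient f u (u + c * h)) \<le> 2 / (1 - \<theta>) * \<phi> \<bar>h\<bar>"
    if uh: "a < u" "u < b" "a < u + h" "u + h < b" "h \<noteq> 0" and c: "0 < c" "c \<le> 1" for u h c
  proof (rule geometric_chain[where q = "\<lambda>h. diff_quotient f u (u + h)", OF _ _ _ \<theta> uh(5) c])
    have "\<bar>h\<bar> < b - a" using uh by linarith
    then show "\<And>s t. 0 < s \<Longrightarrow> s \<le> t \<Longrightarrow> t \<le> \<bar>h\<bar> \<Longrightarrow> \<phi> s \<le> \<phi> t"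
      and "\<And>s. 0 < s \<Longrightarrow> s \<le> \<bar>h\<bar> \<Longrightarrow> \<phi> (s / 4) \<le> \<theta> * \<phi> s"
      using mono decay by auto
    show "norm (diff_quotient f u (u + h') - diff_quotient f u (u + c * h')) \<le> \<phi> \<bar>h'\<bar>"
      if "h' \<noteq> 0" "\<bar>h'\<bar> \<le> \<bar>h\<bar>" "0 < h' / h" "1 / 4 \<le> c" "c \<le> 3 / 4" for h' c
      using that uh by (intro step) (auto simp: zero_less_divide_iff)
  qed
  have flip: "norm (diff_quotient f u (u + h) - diff_quotient f u (u - h)) \<le> \<phi> (2 * \<bar>h\<bar>)"
    if uh: "a < u - \<bar>h\<bar>" "u + \<bar>h\<bar> < b" "h \<noteq> 0" for u h
  proof -
    have "norm (diff_quotient f (u - \<bar>h\<bar>) u - diff_quotient f u (u + \<bar>h\<bar>)) \<le> \<phi> (u + \<bar>h\<bar> - (u - \<bar>h\<bar>))"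
      using uh by (intro three) auto
    then show ?thesis
      by (cases "0 \<le> h") (simp_all add: diff_quotient_commute[of f "u - h"]
        diff_quotient_commute[of f "u + h"] norm_minus_commute)
  qed
  \<comment> \<open>The summand 2/(1-\<theta>) pays for the chain, the summand 1 for one change of
    side.\<close>
  define B where "B = 1 + 2 / (1 - \<theta>)"
  have B: "0 < B" using \<theta> by (simp add: B_def add_pos_pos)
  \<comment> \<open>The farther point v is moved towards u until it is as far from u as v', and then
    reflected if it is on the wrong side. The reflection uses an interval of length 2*|h'|, hence
    the argument 2*d.\<close>
  have main: "norm (diff_quotient f u v - diff_quotient f u v') \<le> B * \<phi> (2 * d)"
    if u: "u \<in> {a<..<b}" and v: "v \<in> {a<..<b}" "v \<noteq> u" and v': "v' \<in> {a<..<b}" "v' \<noteq> u"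
      and le: "\<bar>v' - u\<bar> \<le> \<bar>v - u\<bar>" "\<bar>v - u\<bar> < d" and d: "2 * d < b - a" for u v v' d
  proof -
    define h where "h = v - u"
    define h' where "h' = v' - u"
    define c where "c = \<bar>h'\<bar> / \<bar>h\<bar>"
    have c: "0 < c" "c \<le> 1" using le v v' by (auto simp: c_def h_def h'_def)
    have "norm (diff_quotient f u v - diff_quotient f u (u + c * h)) \<le> 2 / (1 - \<theta>) * \<phi> \<bar>h\<bar>"
      using chain[of u h c] u v c by (simp add: h_def)
    also have "\<dots> \<le> 2 / (1 - \<theta>) * \<phi> (2 * d)"
      using v le d \<theta> by (intro mult_left_mono mono) (auto simp: h_def)
    finally have 1: "norm (diff_quotient f u v - diff_quotient f u (u + c * h)) \<le> 2 / (1 - \<theta>) * \<phi> (2 * d)" .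
    have "\<bar>c * h\<bar> = \<bar>h'\<bar>" using v by (simp add: c_def h_def abs_mult)
    then consider "c * h = h'" | "c * h = - h'" by linarith
    then have 2: "norm (diff_quotient f u (u + c * h) - diff_quotient f u v') \<le> \<phi> (2 * d)"
    proof cases
      case 1
      have "0 < d" using le by linarith
      with 1 show ?thesis using nonneg[of "2 * d"] d by (simp add: h'_def)
    next
      case 2
      have *: "\<bar>c * h\<bar> \<le> \<bar>h\<bar>" using c by (simp add: abs_mult mult_left_le_one_le)
      \<comment> \<open>The mirror image of v' lies between u and v, hence in (a, b).\<close>
      have "a < u - \<bar>h'\<bar> \<and> u + \<bar>h'\<bar> < b"
      proof (cases "0 < h")
        case True
        then have "0 < c * h" using c by simp
        then have "h' < 0" "- h' \<le> h" using 2 * True by auto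
        then show ?thesis using v v' True by (auto simp: h_def h'_def)
      next
        case False
        then have "h < 0" using v by (simp add: h_def)
        then have "c * h < 0" using c by (simp add: mult_pos_neg)
        then have "h' > 0" "h' \<le> - h" using 2 * \<open>h < 0\<close> by auto
        then show ?thesis using v v' \<open>h < 0\<close> by (auto simp: h_def h'_def)
      qed
      then have "norm (diff_quotient f u (u + h') - diff_quotient f u (u - h')) \<le> \<phi> (2 * \<bar>h'\<bar>)"
        using v' by (intro flip) (auto simp: h'_def)
      also have "\<dots> \<le> \<phi> (2 * d)" using v' le d by (intro mono) (auto simp: h'_def)
      finally show ?thesis using 2 by (simp add: h'_def norm_minus_commute)
    qed
    have "norm (diff_quotient f u v - diff_quotient f u v')
      \<le> norm (diff_quotient f u v - diff_quotient f u (u + c * h))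
        + norm (diff_quotient f u (u + c * h) - diff_quotient f u v')"
      using norm_triangle_ineq[of "diff_quotient f u v - diff_quotient f u (u + c * h)"
          "diff_quotient f u (u + c * h) - diff_quotient f u v'"] by simp
    then show ?thesis using 1 2 by (simp add: B_def algebra_simps)
  qed
  show ?thesis
  proof (rule C1_differentiable_on_of_uniformly_Cauchy)
    fix e :: real assume "0 < e"
    then have "0 < e / B" using B by simp
    then obtain s where s: "0 < s" "s < b - a" "\<phi> s \<le> e / B"
      using geometric_decay_small[of "b - a" \<phi> \<theta> "e / B"] decay \<theta> True by auto
    have Be: "B * \<phi> (2 * (s / 2)) \<le> e" using s B by (simp add: field_simps)
    have "norm (diff_quotient f u v - diff_quotient f u v') \<le> e"
      if "u \<in> {a<..<b}" "v \<in> {a<..<b}" "v' \<in> {a<..<b}" "v \<noteq> u" "v' \<noteq> u"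
        "\<bar>v - u\<bar> < s / 2" "\<bar>v' - u\<bar> < s / 2" for u v v'
    proof (cases "\<bar>v' - u\<bar> \<le> \<bar>v - u\<bar>")
      case True
      then show ?thesis using main[of u v v' "s / 2"] that s Be by auto
    next
      case False
      then show ?thesis using main[of u v' v "s / 2"] that s Be by (auto simp: norm_minus_commute)
    qed
    then show "\<exists>d>0. \<forall>u\<in>{a<..<b}. \<forall>v\<in>{a<..<b}. \<forall>v'\<in>{a<..<b}. v \<noteq> u \<and> v' \<noteq> u \<and>
        \<bar>v - u\<bar> < d \<and> \<bar>v' - u\<bar> < d \<longrightarrow> norm (diff_quotient f u v - diff_quotient f u v') \<le> e"
      using s by (intro exI[of _ "s / 2"]) auto
  qed simp
qed

section \<open>Geodesics\<close>

text \<open>Rescaled by A, the lower bound of w on the ball, both difference quotients lie in the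
  unit ball. Their combination with weight \<alpha>/(\<alpha>+\<beta>) collapses to a multiple of y
  - x, whose norm is nearly 1 because the segment from x to y has weighted length at least
  \<alpha>+\<beta>. Convexity applies with \<tau> = 2*\<eta>/m; undoing the rescaling costs 1/A
  \<le> 2/m.\<close>

lemma geodesic_directions_close:
  fixes \<Omega> :: "'a::banach set"
  assumes p: "2 \<le> p" and K: "0 < K"
    and power_type: "\<And>\<epsilon>. 0 < \<epsilon> \<Longrightarrow> \<epsilon> \<le> 2 \<Longrightarrow> K * \<epsilon> powr p \<le> modulus_of_convexity TYPE('a) \<epsilon>"
    and w: "continuous_on \<Omega> w" "\<And>z. z \<in> \<Omega> \<Longrightarrow> 0 < w z"
    and dist: "weighted_dist \<Omega> w z x = \<alpha>" "weighted_dist \<Omega> w z y = \<beta>" "weighted_dist \<Omega> w x y = \<alpha> + \<beta>"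
    and pos: "0 < \<alpha>" "0 < \<beta>"
    and ratio: "1 / 4 \<le> \<alpha> / (\<alpha> + \<beta>)" "\<alpha> / (\<alpha> + \<beta>) \<le> 3 / 4"
    and ball: "cball z R \<subseteq> \<Omega>" "norm (x - z) \<le> R" "norm (y - z) \<le> R"
    and osc: "\<And>v. v \<in> cball z R \<Longrightarrow> \<bar>w v - w z\<bar> \<le> \<eta>"
    and m: "0 < m" "m \<le> w z" "\<eta> \<le> m / 2"
  shows "norm ((z - x) /\<^sub>R \<alpha> - (y - z) /\<^sub>R \<beta>)
    \<le> 2 / m * ((6 / K) powr (1 / p) + 16) * (2 / m) powr (1 / p) * \<eta> powr (1 / p)"
proof -
  have R: "0 \<le> R" using ball(2) norm_ge_zero order_trans by blast
  then have z: "z \<in> cball z R" and x: "x \<in> cball z R" and y: "y \<in> cball z R"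
    using ball by (auto simp: dist_norm norm_minus_commute)
  have \<eta>: "0 \<le> \<eta>" using osc[OF z] by simp
  define A where "A = w z - \<eta>"
  have A: "m / 2 \<le> A" "0 < A" using m by (auto simp: A_def)
  \<comment> \<open>Distances are measured from z because \<open>weighted_dist_ge\<close> asks for
    the bound on a ball about its first point, and here that ball lies inside
    \<open>cball z R\<close>.\<close>
  have lower: "A * norm (z - v) \<le> weighted_dist \<Omega> w z v" if v: "v \<in> cball z R" for v
  proof (rule weighted_dist_ge[OF _ w])
    show "closed_segment z v \<subseteq> \<Omega>"
      using closed_segment_subset[OF z v convex_cball] ball by blast
    fix u assume "norm (u - z) \<le> norm (z - v)"
    then have "u \<in> cball z R" using v by (simp add: dist_norm norm_minus_commute)
    then show "A \<le> w u" using osc[of u] by (simp add: A_def)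
  qed (use A in auto)
  have upper: "\<alpha> + \<beta> \<le> (w z + \<eta>) * norm (x - y)"
    unfolding dist(3)[symmetric]
  proof (rule weighted_dist_le[OF _ w])
    have sub: "closed_segment x y \<subseteq> cball z R"
      by (rule closed_segment_subset[OF x y convex_cball])
    then show "closed_segment x y \<subseteq> \<Omega>" using ball by blast
    show "w v \<le> w z + \<eta>" if "v \<in> closed_segment x y" for v
      using osc[of v] sub that by auto
  qed
  define a where "a = (A / \<alpha>) *\<^sub>R (z - x)"
  define b where "b = (A / \<beta>) *\<^sub>R (y - z)"
  define c where "c = \<alpha> / (\<alpha> + \<beta>)"
  have a: "norm a \<le> 1" and b: "norm b \<le> 1"
    using lower[OF x] lower[OF y] dist pos A by (auto simp: a_def b_def norm_minus_commute)
  have c1: "1 - c = \<beta> / (\<alpha> + \<beta>)" using pos by (simp add: c_def field_simps)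
  have "c * (A / \<alpha>) = A / (\<alpha> + \<beta>)" "(1 - c) * (A / \<beta>) = A / (\<alpha> + \<beta>)"
    using pos unfolding c1 by (simp_all add: c_def)
  then have "c *\<^sub>R a + (1 - c) *\<^sub>R b = (A / (\<alpha> + \<beta>)) *\<^sub>R (z - x) + (A / (\<alpha> + \<beta>)) *\<^sub>R (y - z)"
    by (simp only: a_def b_def scaleR_scaleR)
  also have "\<dots> = (A / (\<alpha> + \<beta>)) *\<^sub>R (y - x)"
    by (simp flip: scaleR_add_right)
  finally have comb: "norm (c *\<^sub>R a + (1 - c) *\<^sub>R b) = A * (norm (x - y) / (\<alpha> + \<beta>))"
    using A pos by (simp add: norm_minus_commute)
  have wz: "0 < w z + \<eta>" using m \<eta> by simp
  \<comment> \<open>The quotient (w z - \<eta>)/(w z + \<eta>) falls short of 1 by 2*\<eta>/(w z +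
    \<eta>), and w z \<ge> m.\<close>
  have "1 - 2 / m * \<eta> \<le> A / (w z + \<eta>)"
  proof -
    have "2 * \<eta> / (w z + \<eta>) \<le> 2 * \<eta> / m"
      using m \<eta> by (intro divide_left_mono) auto
    moreover have "A / (w z + \<eta>) = 1 - 2 * \<eta> / (w z + \<eta>)"
      using wz by (simp add: A_def field_simps)
    ultimately show ?thesis by simp
  qed
  also have "\<dots> = A * (1 / (w z + \<eta>))" by simp
  also have "\<dots> \<le> A * (norm (x - y) / (\<alpha> + \<beta>))"
    using upper wz pos A by (intro mult_left_mono) (auto simp: field_simps)
  finally have "1 - 2 / m * \<eta> \<le> norm (c *\<^sub>R a + (1 - c) *\<^sub>R b)"
    by (simp only: comb)
  then have "norm (a - b) \<le> ((6 / K) powr (1 / p) + 16) * (2 / m * \<eta>) powr (1 / p)"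
    using norm_diff_le_of_convex_comb_ge[OF p K power_type a b, of c "2 / m * \<eta>"] ratio m \<eta>
    by (simp add: c_def)
  also have "(2 / m * \<eta>) powr (1 / p) = (2 / m) powr (1 / p) * \<eta> powr (1 / p)"
    by (rule powr_mult)
  finally have ab: "norm (a - b) \<le> ((6 / K) powr (1 / p) + 16) * ((2 / m) powr (1 / p) * \<eta> powr (1 / p))" .
  have "(z - x) /\<^sub>R \<alpha> - (y - z) /\<^sub>R \<beta> = (1 / A) *\<^sub>R (a - b)"
  proof -
    have "(1 / A) *\<^sub>R a = (z - x) /\<^sub>R \<alpha>" "(1 / A) *\<^sub>R b = (y - z) /\<^sub>R \<beta>"
      using A by (simp_all add: a_def b_def inverse_eq_divide)
    then show ?thesis by (simp only: scaleR_diff_right)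
  qed
  then have "norm ((z - x) /\<^sub>R \<alpha> - (y - z) /\<^sub>R \<beta>) = 1 / A * norm (a - b)"
    using A by simp
  also have "\<dots> \<le> 2 / m * norm (a - b)"
    using A m by (intro mult_right_mono) (auto simp: field_simps)
  also have "\<dots> \<le> 2 / m * (((6 / K) powr (1 / p) + 16) * ((2 / m) powr (1 / p) * \<eta> powr (1 / p)))"
    using ab m by (intro mult_left_mono) auto
  finally show ?thesis by (simp only: mult.assoc)
qed

theorem theorem3p1:
  fixes \<Omega> :: "'a::banach set" and w :: "'a \<Rightarrow> real" and p K :: real
    and x y :: 'a and \<gamma> :: "real \<Rightarrow> 'a"
  assumes dim: "\<exists>u v::'a. u \<noteq> v \<and> independent {u, v}"
    and uc: "uniformly_convex TYPE('a)"
    and p: "2 \<le> p" and K: "0 < K"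
    and power_type: "\<And>\<epsilon>. 0 < \<epsilon> \<Longrightarrow> \<epsilon> \<le> 2 \<Longrightarrow> K * \<epsilon> powr p \<le> modulus_of_convexity TYPE('a) \<epsilon>"
    and \<Omega>: "\<Omega> \<noteq> {}" "open \<Omega>" "connected \<Omega>"
    and w_cont: "continuous_on \<Omega> w" and w_pos: "\<And>z. z \<in> \<Omega> \<Longrightarrow> 0 < w z"
    and limsup: "finite_limsup_condition (modulus_of_continuity \<Omega> w)"
    and geodesic: "weighted_geodesic \<Omega> w x y \<gamma>"
  shows "\<gamma> C1_differentiable_on {0<..<weighted_dist \<Omega> w x y}"
proof (rule C1_differentiable_on_locally)
  fix t0 assume t0: "t0 \<in> {0<..<weighted_dist \<Omega> w x y}"
  define l where "l = weighted_dist \<Omega> w x y"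
  have cont: "continuous_on {0..l} \<gamma>" and in\<Omega>: "\<gamma> ` {0..l} \<subseteq> \<Omega>"
    and dist\<gamma>: "\<And>s t. s \<in> {0..l} \<Longrightarrow> t \<in> {0..l} \<Longrightarrow> weighted_dist \<Omega> w (\<gamma> s) (\<gamma> t) = \<bar>s - t\<bar>"
    using geodesic by (auto simp: weighted_geodesic_def Let_def rectifiable_path_in_def l_def)
  have t0l: "0 < t0" "t0 < l" using t0 by (auto simp: l_def)
  define z0 where "z0 = \<gamma> t0"
  have z0: "z0 \<in> \<Omega>" using in\<Omega> t0l by (auto simp: z0_def)
  define m where "m = w z0 / 2"
  have m: "0 < m" using w_pos[OF z0] by (simp add: m_def)
  obtain s1 \<theta> \<psi> where s1: "0 < s1" and \<theta>: "0 < \<theta>" "\<theta> < 1"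
    and \<psi>_props: "\<forall>s. 0 < s \<and> s < s1 \<longrightarrow> 0 \<le> \<psi> s \<and>
      modulus_of_continuity \<Omega> w s \<le> ennreal (\<psi> s) \<and> \<psi> (s / 4) \<le> \<theta> * \<psi> s"
      "\<forall>s t. 0 < s \<and> s \<le> t \<and> t < s1 \<longrightarrow> \<psi> s \<le> \<psi> t"
    by (rule finite_limsup_condition_geometric_majorant[OF limsup modulus_of_continuity_mono])
  have \<psi>_nonneg: "\<And>s. 0 < s \<Longrightarrow> s < s1 \<Longrightarrow> 0 \<le> \<psi> s"
    and \<psi>: "\<And>s. 0 < s \<Longrightarrow> s < s1 \<Longrightarrow> modulus_of_continuity \<Omega> w s \<le> ennreal (\<psi> s)"
    and \<psi>_mono: "\<And>s t. 0 < s \<Longrightarrow> s \<le> t \<Longrightarrow> t < s1 \<Longrightarrow> \<psi> s \<le> \<psi> t"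
    and \<psi>_decay: "\<And>s. 0 < s \<Longrightarrow> s < s1 \<Longrightarrow> \<psi> (s / 4) \<le> \<theta> * \<psi> s"
    using \<psi>_props by simp_all
  have osc: "\<bar>w u - w v\<bar> \<le> \<psi> s" if "u \<in> \<Omega>" "v \<in> \<Omega>" "norm (u - v) \<le> s" "0 < s" "s < s1" for u v s
  proof -
    have "ennreal \<bar>w u - w v\<bar> \<le> modulus_of_continuity \<Omega> w s"
      unfolding modulus_of_continuity_def using that by (intro Sup_upper) blast
    then have "ennreal \<bar>w u - w v\<bar> \<le> ennreal (\<psi> s)" using \<psi>[of s] that by auto
    then show ?thesis using \<psi>_nonneg[of s] that by (simp add: ennreal_le_iff)
  qed
  \<comment> \<open>Below R0 the oscillation of w is at most m/2, the smallness that
    \<open>geodesic_directions_close\<close> demands.\<close>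
  obtain R0 where R0: "0 < R0" "R0 < s1" "\<psi> R0 \<le> m / 2"
    using geometric_decay_small[of s1 \<psi> \<theta> "m / 2"] \<psi>_decay \<theta> s1 m by auto
  \<comment> \<open>The radius 3*r leaves room for balls about points of \<open>ball z0 r\<close>:
    two such points are less than 2*r apart, and the comparison of weighted distances needs a ball
    of that radius.\<close>
  obtain r where r: "0 < r" "ball z0 (3 * r) \<subseteq> \<Omega>" "\<And>v. v \<in> ball z0 (3 * r) \<Longrightarrow> m \<le> w v"
  proof -
    obtain r1 where r1: "r1 > 0" "ball z0 r1 \<subseteq> \<Omega>" using \<Omega>(2) z0 openE by blast
    obtain r2 where r2: "r2 > 0" "\<And>v. v \<in> \<Omega> \<Longrightarrow> dist v z0 < r2 \<Longrightarrow> dist (w v) (w z0) < m"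
      using w_cont z0 m unfolding continuous_on_iff by blast
    show thesis
    proof (rule that[of "min r1 r2 / 3"])
      show "m \<le> w v" if "v \<in> ball z0 (3 * (min r1 r2 / 3))" for v
      proof -
        have "v \<in> \<Omega>" "dist v z0 < r2" using that r1 by (auto simp: dist_commute)
        then have "\<bar>w v - w z0\<bar> < w z0 / 2"
          using r2(2)[of v] by (simp add: dist_real_def m_def)
        then show ?thesis unfolding m_def by linarith
      qed
    qed (use r1 r2 in auto)
  qed
  obtain \<delta>1 where \<delta>1: "0 < \<delta>1" "\<And>t. t \<in> {0..l} \<Longrightarrow> \<bar>t - t0\<bar> < \<delta>1 \<Longrightarrow> \<gamma> t \<in> ball z0 r"
    using cont[unfolded continuous_on_iff, rule_format, of t0 r] t0l r(1)
    by (auto simp: z0_def dist_real_def dist_commute)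
  \<comment> \<open>The entry \<delta>1 keeps the curve in \<open>ball z0 r\<close>, and t0 and l -
    t0 keep the parameters in {0..l}. The last two ensure that the norm bound (t-s)/m stays below R0
    and r, since t - s < 2*\<delta>.\<close>
  define \<delta> where "\<delta> = Min {\<delta>1, t0, l - t0, m * R0 / 2, m * r / 2}"
  have \<delta>: "0 < \<delta>" "\<delta> \<le> \<delta>1" "\<delta> \<le> t0" "\<delta> \<le> l - t0" "2 * \<delta> \<le> m * R0" "2 * \<delta> \<le> m * r"
  proof -
    show "0 < \<delta>" using \<delta>1(1) t0l m R0 r by (simp add: \<delta>_def)
    have "\<delta> \<le> c" if "c \<in> {\<delta>1, t0, l - t0, m * R0 / 2, m * r / 2}" for c
      unfolding \<delta>_def using that by (intro Min_le) auto
    from this[of \<delta>1] this[of t0] this[of "l - t0"] this[of "m * R0 / 2"] this[of "m * r / 2"]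
    show "\<delta> \<le> \<delta>1" "\<delta> \<le> t0" "\<delta> \<le> l - t0" "2 * \<delta> \<le> m * R0" "2 * \<delta> \<le> m * r"
      by simp_all
  qed
  define a where "a = t0 - \<delta>"
  define b where "b = t0 + \<delta>"
  have J: "t \<in> {0..l}" "\<gamma> t \<in> ball z0 r" if "a < t" "t < b" for t
    using that \<delta> \<delta>1(2)[of t] by (auto simp: a_def b_def abs_less_iff)
  \<comment> \<open>The curve is parametrized by weighted length and w \<ge> m nearby, so it is
    Lipschitz with constant 1/m.\<close>
  have lip: "norm (\<gamma> s - \<gamma> t) \<le> \<bar>s - t\<bar> / m" if "a < s" "s < b" "a < t" "t < b" for s t
  proof -
    have s: "\<gamma> s \<in> ball z0 r" and t: "\<gamma> t \<in> ball z0 r" using J that by auto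
    have "m * norm (\<gamma> s - \<gamma> t) \<le> weighted_dist \<Omega> w (\<gamma> s) (\<gamma> t)"
    proof (rule weighted_dist_ge[OF _ w_cont w_pos])
      have "ball z0 r \<subseteq> \<Omega>" using r(1,2) subset_ball[of r "3 * r" z0] by simp
      then show "closed_segment (\<gamma> s) (\<gamma> t) \<subseteq> \<Omega>"
        using closed_segment_subset[OF s t convex_ball] by blast
      fix v assume v: "norm (v - \<gamma> s) \<le> norm (\<gamma> s - \<gamma> t)"
      have "dist z0 v < 3 * r"
        using s t v dist_triangle[of z0 v "\<gamma> s"] dist_triangle[of "\<gamma> s" "\<gamma> t" z0]
        by (simp add: dist_norm norm_minus_commute)
      then show "m \<le> w v" using r(3) by simp
    qed (use m in auto)
    then show ?thesis using dist\<gamma>[of s t] J that m by (simp add: field_simps)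
  qed
  define C where "C = 2 / m * ((6 / K) powr (1 / p) + 16) * (2 / m) powr (1 / p)"
  have C: "0 \<le> C" using m by (simp add: C_def)
  have small: "h / m < R0" "h / m < s1" if "h < b - a" for h
  proof -
    have "h < R0 * m" using that \<delta> by (simp add: a_def b_def mult.commute)
    then show "h / m < R0" using m by (simp add: pos_divide_less_eq)
    then show "h / m < s1" using R0 by simp
  qed
  have "\<gamma> C1_differentiable_on {a<..<b}"
  proof (rule C1_differentiable_on_of_three_points[where \<phi> = "\<lambda>h. C * \<psi> (h / m) powr (1 / p)"])
    fix s u t assume st: "a < s" "s < u" "u < t" "t < b"
      and ratio: "1 / 4 \<le> (u - s) / (t - s)" "(u - s) / (t - s) \<le> 3 / 4"
    \<comment> \<open>By \<open>lip\<close> this radius about \<gamma> u reaches both \<gamma> s and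
      \<gamma> t.\<close>
    define R where "R = (t - s) / m"
    have R: "0 < R" "R < R0" using st small[of "t - s"] m by (auto simp: R_def)
    have "t - s < m * r" using st \<delta> by (simp add: a_def b_def)
    then have "R < r" using m by (simp add: R_def pos_divide_less_eq mult.commute)
    have zu: "\<gamma> u \<in> ball z0 r" "\<gamma> u \<in> \<Omega>" using J[of u] in\<Omega> st by auto
    have sub: "cball (\<gamma> u) R \<subseteq> ball z0 (3 * r)"
    proof
      fix v assume "v \<in> cball (\<gamma> u) R"
      then show "v \<in> ball z0 (3 * r)"
        using dist_triangle[of z0 v "\<gamma> u"] zu \<open>R < r\<close> r(1) by simp
    qed
    have near: "norm (\<gamma> v - \<gamma> u) \<le> R" if "v = s \<or> v = t" for v
    proof -
      have "norm (\<gamma> v - \<gamma> u) \<le> \<bar>v - u\<bar> / m" using that st by (intro lip) auto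
      also have "\<dots> \<le> R" unfolding R_def using that st m by (intro divide_right_mono) auto
      finally show ?thesis .
    qed
    have "norm ((\<gamma> u - \<gamma> s) /\<^sub>R (u - s) - (\<gamma> t - \<gamma> u) /\<^sub>R (t - u)) \<le> C * \<psi> R powr (1 / p)"
      unfolding C_def
    proof (rule geodesic_directions_close[OF p K power_type w_cont w_pos])
      show "cball (\<gamma> u) R \<subseteq> \<Omega>" using sub r by blast
      show "\<bar>w v - w (\<gamma> u)\<bar> \<le> \<psi> R" if "v \<in> cball (\<gamma> u) R" for v
        using that sub r R R0 zu by (intro osc) (auto simp: dist_norm norm_minus_commute)
      show "\<psi> R \<le> m / 2" using \<psi>_mono[of R R0] R R0 by simp
      show "m \<le> w (\<gamma> u)" using zu(1) r(1) by (intro r(3)) auto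
    qed (use st J dist\<gamma> ratio near m in \<open>auto simp: abs_if\<close>)
    then show "norm (diff_quotient \<gamma> s u - diff_quotient \<gamma> u t) \<le> C * \<psi> ((t - s) / m) powr (1 / p)"
      by (simp add: diff_quotient_def R_def)
  next
    fix s t assume st: "0 < s" "s \<le> t" "t < b - a"
    have "\<psi> (s / m) \<le> \<psi> (t / m)" "0 \<le> \<psi> (s / m)"
      using st small[of t] small[of s] m by (auto intro!: \<psi>_mono \<psi>_nonneg divide_right_mono)
    then show "C * \<psi> (s / m) powr (1 / p) \<le> C * \<psi> (t / m) powr (1 / p)"
      using C p by (intro mult_left_mono powr_mono2) auto
  next
    fix s assume s: "0 < s" "s < b - a"
    have "\<psi> (s / m / 4) \<le> \<theta> * \<psi> (s / m)" "0 \<le> \<psi> (s / m / 4)" "0 \<le> \<psi> (s / m)"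
    proof -
      have sm: "0 < s / m" "s / m < s1" using s small[of s] m by auto
      then show "\<psi> (s / m / 4) \<le> \<theta> * \<psi> (s / m)" "0 \<le> \<psi> (s / m)"
        by (rule \<psi>_decay, rule \<psi>_nonneg)
      have "0 < v / 4 \<and> v / 4 < s1" if "0 < v" "v < s1" for v
        using that by linarith
      from this[OF sm] show "0 \<le> \<psi> (s / m / 4)" by (intro \<psi>_nonneg) auto
    qed
    then have "\<psi> (s / m / 4) powr (1 / p) \<le> (\<theta> * \<psi> (s / m)) powr (1 / p)"
      using p by (intro powr_mono2) auto
    also have "\<dots> = \<theta> powr (1 / p) * \<psi> (s / m) powr (1 / p)"
      by (rule powr_mult)
    finally have "C * \<psi> (s / m / 4) powr (1 / p) \<le> C * (\<theta> powr (1 / p) * \<psi> (s / m) powr (1 / p))"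
      using C by (rule mult_left_mono)
    then show "C * \<psi> (s / 4 / m) powr (1 / p) \<le> \<theta> powr (1 / p) * (C * \<psi> (s / m) powr (1 / p))"
      by (simp add: mult_ac)
  next
    show "0 < \<theta> powr (1 / p)" using \<theta> by simp
    show "\<theta> powr (1 / p) < 1" using \<theta> p powr_less_mono2[of "1 / p" \<theta> 1] by simp
  qed
  then show "\<exists>J. open J \<and> t0 \<in> J \<and> \<gamma> C1_differentiable_on J"
    using \<delta> by (intro exI[of _ "{a<..<b}"]) (auto simp: a_def b_def)
qed

end
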